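(* Consider the posterior covariance operator $$\mathcal{C}_{\mathrm{post}}(\boldsymbol\xi)=\mathcal{H}(\boldsymbol\xi)^{-1},\qquad \mathcal{H}(\boldsymbol\xi)=\sigma^{-2}\mathcal{F}(\boldsymbol\xi)^*\mathcal{F}(\boldsymbol\xi)+\mathcal{C}_{\mathrm{pr}}^{-1},\qquad \mathcal{F}(\boldsymbol\xi)=\mathcal{B}(\boldsymbol\xi)\mathcal{S},$$ with the solution operator $\mathcal{S}$, path observation operator $\mathcal{B}(\boldsymbol\xi)$, noise variance $\sigma^2$ and prior covariance operator $\mathcal{C}_{\mathrm{pr}}$ as in the context. Then, for $\boldsymbol\xi\in\mathbb{R}^N$ and $j\in\{1,\dots,N\}$, writing $\partial_j=\partial/\partial\xi_j$, $$\partial_j\mathcal{C}_{\mathrm{post}}(\boldsymbol\xi)=-\mathcal{C}_{\mathrm{post}}(\boldsymbol\xi)\,\big(\partial_j\mathcal{H}(\boldsymbol\xi)\big)\,\mathcal{C}_{\mathrm{post}}(\boldsymbol\xi),$$ $$\partial_j\mathcal{H}(\boldsymbol\xi)=\sigma^{-2}\,\mathcal{S}^*\Big(\sum_{k=1}^{n_y}\tau_k\delta_{\boldsymbol r}(\boldsymbol\xi)\otimes\tau_k\partial_j\delta_{\boldsymbol r}(\boldsymbol\xi)+\tau_k\partial_j\delta_{\boldsymbol r}(\boldsymbol\xi)\otimes\tau_k\delta_{\boldsymbol r}(\boldsymbol\xi)\Big)\mathcal{S}.$$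
   Context: $\Omega\subset\mathbb{R}^2$ is open, bounded and convex; $T\subset\mathbb{R}$ is a bounded time interval. $\mathscr{M}=L^2(\Omega)$ with inner product $\langle f,g\rangle=\int_\Omega fg\,d\boldsymbol x$, and $\mathscr{U}=L^2(\Omega\times T)$ with inner product $\langle\!\langle u,v\rangle\!\rangle=\int_T\int_\Omega uv\,d\boldsymbol x\,dt$ (real-valued functions). $\mathcal{L}(X,Y)$ denotes the bounded linear operators from $X$ to $Y$, and $\mathcal{L}(X)=\mathcal{L}(X,X)$. For $u,v\in\mathscr{U}$, $u\otimes v\in\mathcal{L}(\mathscr{U})$ is defined by $(u\otimes v)w=u\,\langle\!\langle v,w\rangle\!\rangle$. A parameterized path is a map $\boldsymbol r:T_y\times\mathbb{R}^N\to\Omega$, $(t,\boldsymbol\xi)\mapsto\boldsymbol r(t;\boldsymbol\xi)$, where $T_y\subset T$ is called the inversion interval; the partial derivatives of $\boldsymbol r$ with respect to the path parameter $\boldsymbol\xi$ are assumed to exist and to be continuous. The measurement times are $\{t_k\}_{k=1}^{n_y}\subset T_y$. With constants $\varepsilon_{\boldsymbol x},\varepsilon_t>0$, $$\delta_{\boldsymbol r}(\boldsymbol x,t)(\boldsymbol\xi)=(2\pi\varepsilon_{\boldsymbol x})^{-1}\exp\Big\{-\frac{\|\boldsymbol x-\boldsymbol r(t;\boldsymbol\xi)\|_2^2}{2\varepsilon_{\boldsymbol x}}\Big\},\qquad \tau_k(t)=\big(\sqrt{2\pi\varepsilon_t}\big)^{-1}\exp\Big\{-\frac{(t-t_k)^2}{2\varepsilon_t}\Big\}.$$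 $\delta_{\boldsymbol r}(\boldsymbol\xi)$ is the function $(\boldsymbol x,t)\mapsto\delta_{\boldsymbol r}(\boldsymbol x,t)(\boldsymbol\xi)$ and $\partial_j\delta_{\boldsymbol r}(\boldsymbol\xi)$ is its partial derivative with respect to $\xi_j$. The observation operator $\mathcal{B}(\boldsymbol\xi)\in\mathcal{L}(\mathscr{U},\mathbb{R}^{n_y})$ is $(\mathcal{B}(\boldsymbol\xi)u)_k=\langle\!\langle\tau_k\delta_{\boldsymbol r}(\boldsymbol\xi),u\rangle\!\rangle$, $k\in\{1,\dots,n_y\}$. The solution operator $\mathcal{S}\in\mathcal{L}(\mathscr{M},\mathscr{U})$ does not depend on $\boldsymbol\xi$, and $\sigma^2>0$ is the variance of the measurement noise. The prior covariance operator is $\mathcal{C}_{\mathrm{pr}}=\mathcal{E}^{-2}$, where $\mathcal{E}=-a_1\Delta+a_2\mathcal{I}$ with $a_1,a_2>0$ is an elliptic differential operator; $\mathcal{C}_{\mathrm{pr}}$ is a bounded, self-adjoint, strictly positive, trace-class operator on $\mathscr{M}$, and $\mathcal{C}_{\mathrm{pr}}^{-1}$ is its densely defined, unbounded inverse. $\mathcal{C}_{\mathrm{post}}(\boldsymbol\xi)$ is a bounded, self-adjoint, strictly positive, trace-class operator on $\mathscr{M}$. Derivatives of operator-valued maps are limits of difference quotients in operator norm, and derivatives of $\mathscr{U}$-valued maps are limits of difference quotients in the norm of $\mathscr{U}$. Since $\mathcal{C}_{\mathrm{pr}}^{-1}$ is independent of $\boldsymbol\xi$, $\partial_j\mathcal{H}(\boldsymbol\xi)$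 is the derivative of $\sigma^{-2}\mathcal{F}(\boldsymbol\xi)^*\mathcal{F}(\boldsymbol\xi)$.
   Formalization: The inversion interval T_y is taken to be closed (compact) and the partial derivatives of r jointly continuous in (t, ξ); on a non-closed T_y, e.g. with r = c·sin(ξ/t), the derivative ∂_jδ_r need not lie in L²(Ω×T), so the formula would be undefined. *)

theory Defs
  imports "HOL-Analysis.Analysis"
begin

section \<open>The real Hilbert space of square-integrable functions\<close>

definition square_integrable :: "('a::euclidean_space \<Rightarrow> real) \<Rightarrow> bool" where
  "square_integrable f \<longleftrightarrow>
     f \<in> borel_measurable lebesgue \<and> integrable lebesgue (\<lambda>x. (f x)\<^sup>2)"

definition L2_rel :: "('a::euclidean_space \<Rightarrow> real) \<Rightarrow> ('a \<Rightarrow> real) \<Rightarrow> bool" where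
  "L2_rel f g \<longleftrightarrow> square_integrable f \<and> square_integrable g \<and> (AE x in lebesgue. f x = g x)"

lemma square_integrable_zero: "square_integrable (\<lambda>_. 0)"
  by (simp add: square_integrable_def)

lemma square_integrable_prod:
  assumes "square_integrable f" "square_integrable g"
  shows "integrable lebesgue (\<lambda>x. f x * g x)"
proof (rule Bochner_Integration.integrable_bound)
  show "integrable lebesgue (\<lambda>x. (f x)\<^sup>2 + (g x)\<^sup>2)"
    using assms by (auto simp: square_integrable_def)
  show "(\<lambda>x. f x * g x) \<in> borel_measurable lebesgue"
    using assms by (auto simp: square_integrable_def)
  have "\<bar>a * b\<bar> \<le> \<bar>a\<^sup>2 + b\<^sup>2\<bar>" for a b :: real
  proof -
    have "0 \<le> (\<bar>a\<bar> - \<bar>b\<bar>)\<^sup>2" by simp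
    then have "2 * (\<bar>a\<bar> * \<bar>b\<bar>) \<le> a\<^sup>2 + b\<^sup>2"
      by (simp add: power2_diff)
    moreover have "0 \<le> \<bar>a\<bar> * \<bar>b\<bar>" by simp
    ultimately show ?thesis unfolding abs_mult by linarith
  qed
  then show "AE x in lebesgue. norm (f x * g x) \<le> norm ((f x)\<^sup>2 + (g x)\<^sup>2)"
    by simp
qed

lemma square_integrable_add:
  assumes "square_integrable f" "square_integrable g"
  shows "square_integrable (\<lambda>x. f x + g x)"
proof -
  have "integrable lebesgue (\<lambda>x. (f x)\<^sup>2 + (g x)\<^sup>2 + 2 * (f x * g x))"
    using assms square_integrable_prod[OF assms] by (auto simp: square_integrable_def)
  moreover have "(\<lambda>x. (f x)\<^sup>2 + (g x)\<^sup>2 + 2 * (f x * g x)) = (\<lambda>x. (f x + g x)\<^sup>2)"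
    by (auto simp: power2_sum)
  ultimately show ?thesis
    using assms by (auto simp: square_integrable_def)
qed

lemma square_integrable_scale:
  "square_integrable f \<Longrightarrow> square_integrable (\<lambda>x. c * f x)"
  by (auto simp: square_integrable_def power_mult_distrib)

lemma square_integrable_uminus:
  "square_integrable f \<Longrightarrow> square_integrable (\<lambda>x. - f x)"
  by (auto simp: square_integrable_def)

lemma square_integrable_diff:
  "square_integrable f \<Longrightarrow> square_integrable g \<Longrightarrow> square_integrable (\<lambda>x. f x - g x)"
  using square_integrable_add[of f "\<lambda>x. - g x"] square_integrable_uminus[of g] by simp

quotient_type (overloaded) 'a L2 = "'a::euclidean_space \<Rightarrow> real" / partial: L2_rel
proof (rule part_equivpI)
  show "\<exists>f. L2_rel f f"
    by (auto simp: L2_rel_def intro!: exI[of _ "\<lambda>_. 0"] square_integrable_zero)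
  show "symp L2_rel"
    by (auto simp: symp_def L2_rel_def)
  show "transp L2_rel"
    by (auto simp: transp_def L2_rel_def elim: AE_mp)
qed

instantiation L2 :: (euclidean_space) real_inner
begin

lift_definition zero_L2 :: "'a L2" is "\<lambda>_. 0"
  by (simp add: L2_rel_def square_integrable_zero)

lift_definition plus_L2 :: "'a L2 \<Rightarrow> 'a L2 \<Rightarrow> 'a L2" is "\<lambda>f g x. f x + g x"
  by (auto simp: L2_rel_def square_integrable_add)

lift_definition minus_L2 :: "'a L2 \<Rightarrow> 'a L2 \<Rightarrow> 'a L2" is "\<lambda>f g x. f x - g x"
  by (auto simp: L2_rel_def square_integrable_diff)

lift_definition uminus_L2 :: "'a L2 \<Rightarrow> 'a L2" is "\<lambda>f x. - f x"
  by (auto simp: L2_rel_def square_integrable_uminus)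

lift_definition scaleR_L2 :: "real \<Rightarrow> 'a L2 \<Rightarrow> 'a L2" is "\<lambda>c f x. c * f x"
  by (auto simp: L2_rel_def square_integrable_scale)

lift_definition inner_L2 :: "'a L2 \<Rightarrow> 'a L2 \<Rightarrow> real" is "\<lambda>f g. \<integral>x. f x * g x \<partial>lebesgue"
  by (rule integral_cong_AE) (auto simp: L2_rel_def square_integrable_def)

definition norm_L2 :: "'a L2 \<Rightarrow> real" where
  "norm_L2 f = sqrt (inner f f)"

definition sgn_L2 :: "'a L2 \<Rightarrow> 'a L2" where
  "sgn_L2 f = inverse (norm f) *\<^sub>R f"

definition dist_L2 :: "'a L2 \<Rightarrow> 'a L2 \<Rightarrow> real" where
  "dist_L2 f g = norm (f - g)"

definition uniformity_L2 :: "('a L2 \<times> 'a L2) filter" where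
  "uniformity_L2 = (INF e\<in>{0<..}. principal {(f, g). dist f g < e})"

definition open_L2 :: "'a L2 set \<Rightarrow> bool" where
  "open_L2 U \<longleftrightarrow> (\<forall>f\<in>U. eventually (\<lambda>(f', g). f' = f \<longrightarrow> g \<in> U) uniformity)"

instance
proof
  fix f g h :: "'a L2" and a b :: real
  show "f + g + h = f + (g + h)"
    by transfer (auto simp: L2_rel_def square_integrable_add algebra_simps)
  show "f + g = g + f"
    by transfer (auto simp: L2_rel_def square_integrable_add algebra_simps)
  show "0 + f = f"
    by transfer (auto simp: L2_rel_def)
  show "- f + f = 0"
    by transfer (auto simp: L2_rel_def square_integrable_zero)
  show "f - g = f + - g"
    by transfer (auto simp: L2_rel_def square_integrable_diff)
  show "a *\<^sub>R (f + g) = a *\<^sub>R f + a *\<^sub>R g"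
    by transfer (auto simp: L2_rel_def square_integrable_add square_integrable_scale
        distrib_left)
  show "(a + b) *\<^sub>R f = a *\<^sub>R f + b *\<^sub>R f"
    by transfer (auto simp: L2_rel_def square_integrable_add square_integrable_scale
        distrib_right)
  show "a *\<^sub>R b *\<^sub>R f = (a * b) *\<^sub>R f"
    by transfer (auto simp: L2_rel_def square_integrable_scale mult.assoc)
  show "1 *\<^sub>R f = f"
    by transfer (auto simp: L2_rel_def)
  show "inner f g = inner g f"
    by transfer (simp add: mult.commute)
  show "inner (f + g) h = inner f h + inner g h"
    by transfer (auto simp: L2_rel_def distrib_right square_integrable_prod)
  show "inner (a *\<^sub>R f) g = a * inner f g"
    by transfer (simp add: mult.assoc)
  show "0 \<le> inner f f"
    by transfer simp
  show "inner f f = 0 \<longleftrightarrow> f = 0"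
    by transfer
      (auto simp: L2_rel_def integral_nonneg_eq_0_iff_AE square_integrable_prod
        square_integrable_zero)
  show "norm f = sqrt (inner f f)"
    by (rule norm_L2_def)
  show "sgn f = inverse (norm f) *\<^sub>R f"
    by (rule sgn_L2_def)
  show "dist f g = norm (f - g)"
    by (rule dist_L2_def)
  show "(uniformity :: ('a L2 \<times> 'a L2) filter) = (INF e\<in>{0<..}. principal {(f, g). dist f g < e})"
    by (rule uniformity_L2_def)
  show "open U \<longleftrightarrow> (\<forall>f\<in>U. eventually (\<lambda>(f', g). f' = f \<longrightarrow> g \<in> U) uniformity)" for U :: "'a L2 set"
    by (rule open_L2_def)
qed

end

text \<open>
  The space of square-integrable functions on a measurable set \<open>A\<close> is the closed subspace of
  those elements that vanish almost everywhere outside \<open>A\<close>; a function given on \<open>A\<close> is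
  extended by zero. On this subspace the inner product is the integral of the product over \<open>A\<close>.
\<close>

definition L2_on :: "'a::euclidean_space set \<Rightarrow> 'a L2 set" where
  "L2_on A = {f. AE x in lebesgue. x \<notin> A \<longrightarrow> rep_L2 f x = 0}"

text \<open>Meaningful only when \<open>f\<close> is square-integrable on \<open>A\<close>.\<close>

definition L2_of :: "'a::euclidean_space set \<Rightarrow> ('a \<Rightarrow> real) \<Rightarrow> 'a L2" where
  "L2_of A f = abs_L2 (\<lambda>x. if x \<in> A then f x else 0)"


section \<open>Operators on subspaces\<close>

text \<open>
  An operator between subspaces \<open>X\<close> and \<open>Y\<close> is a function on the ambient types, of which only
  the values on \<open>X\<close> matter.
\<close>

definition bounded_operator ::
  "'a::real_normed_vector set \<Rightarrow> 'b::real_normed_vector set \<Rightarrow> ('a \<Rightarrow> 'b) \<Rightarrow> bool" where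
  "bounded_operator X Y A \<longleftrightarrow>
     A ` X \<subseteq> Y \<and>
     (\<forall>f\<in>X. \<forall>g\<in>X. A (f + g) = A f + A g) \<and>
     (\<forall>c. \<forall>f\<in>X. A (c *\<^sub>R f) = c *\<^sub>R A f) \<and>
     (\<exists>K. \<forall>f\<in>X. norm (A f) \<le> K * norm f)"

text \<open>As for \<^const>\<open>onorm\<close>, the supremum is meaningful for bounded operators only.\<close>

definition onorm_on ::
  "'a::real_normed_vector set \<Rightarrow> ('a \<Rightarrow> 'b::real_normed_vector) \<Rightarrow> real" where
  "onorm_on X A = (SUP f\<in>X. norm (A f) / norm f)"

definition adjoint_on ::
  "'a::real_inner set \<Rightarrow> ('a \<Rightarrow> 'b::real_inner) \<Rightarrow> 'b \<Rightarrow> 'a" where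
  "adjoint_on X A v = (THE f. f \<in> X \<and> (\<forall>g\<in>X. inner (A g) v = inner g f))"

definition self_adjoint_on :: "'a::real_inner set \<Rightarrow> ('a \<Rightarrow> 'a) \<Rightarrow> bool" where
  "self_adjoint_on X A \<longleftrightarrow> (\<forall>f\<in>X. \<forall>g\<in>X. inner (A f) g = inner f (A g))"

definition strictly_positive_on :: "'a::real_inner set \<Rightarrow> ('a \<Rightarrow> 'a) \<Rightarrow> bool" where
  "strictly_positive_on X A \<longleftrightarrow> (\<forall>f\<in>X. f \<noteq> 0 \<longrightarrow> 0 < inner (A f) f)"

definition orthonormal_basis_of :: "'a::real_inner set \<Rightarrow> 'a set \<Rightarrow> bool" where
  "orthonormal_basis_of X E \<longleftrightarrow>
     E \<subseteq> X \<and> pairwise orthogonal E \<and> (\<forall>e\<in>E. norm e = 1) \<and> closure (span E) = X"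

text \<open>
  For a positive self-adjoint operator the absolute value in the trace norm can be dropped, and
  finiteness of the trace does not depend on the orthonormal basis.
\<close>

definition positive_trace_class_on :: "'a::real_inner set \<Rightarrow> ('a \<Rightarrow> 'a) \<Rightarrow> bool" where
  "positive_trace_class_on X A \<longleftrightarrow>
     (\<exists>E. orthonormal_basis_of X E \<and> (\<lambda>e. inner (A e) e) summable_on E)"

definition covariance_operator :: "'a::real_inner set \<Rightarrow> ('a \<Rightarrow> 'a) \<Rightarrow> bool" where
  "covariance_operator X C \<longleftrightarrow>
     bounded_operator X X C \<and> self_adjoint_on X C \<and> strictly_positive_on X C \<and>
     positive_trace_class_on X C"

definition tensor :: "'a::real_inner \<Rightarrow> 'a \<Rightarrow> 'a \<Rightarrow> 'a" where
  "tensor u v w = inner v w *\<^sub>R u"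


section \<open>Partial derivatives\<close>

definition has_pd ::
  "'n::finite \<Rightarrow> (real^'n \<Rightarrow> 'b::real_normed_vector) \<Rightarrow> real^'n \<Rightarrow> bool" where
  "has_pd j f \<xi> \<longleftrightarrow> (\<lambda>h. f (\<xi> + h *\<^sub>R axis j 1)) differentiable (at 0)"

definition pd ::
  "'n::finite \<Rightarrow> (real^'n \<Rightarrow> 'b::real_normed_vector) \<Rightarrow> real^'n \<Rightarrow> 'b" where
  "pd j f \<xi> = vector_derivative (\<lambda>h. f (\<xi> + h *\<^sub>R axis j 1)) (at 0)"

text \<open>The partial derivative of an operator-valued map, in operator norm.\<close>

definition has_operator_pd ::
  "'a::real_normed_vector set \<Rightarrow> 'n::finite \<Rightarrow> (real^'n \<Rightarrow> 'a \<Rightarrow> 'a) \<Rightarrow> ('a \<Rightarrow> 'a) \<Rightarrow> real^'n \<Rightarrow> bool"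
where
  "has_operator_pd X j A D \<xi> \<longleftrightarrow>
     (\<forall>\<eta>. bounded_operator X X (A \<eta>)) \<and> bounded_operator X X D \<and>
     ((\<lambda>h. onorm_on X (\<lambda>f. (A (\<xi> + h *\<^sub>R axis j 1) f - A \<xi> f) /\<^sub>R h - D f)) \<longlongrightarrow> 0) (at 0)"


section \<open>The elliptic operator defining the prior\<close>

primrec C_k :: "nat \<Rightarrow> (real^'n::finite \<Rightarrow> real) \<Rightarrow> bool" where
  "C_k 0 f \<longleftrightarrow> continuous_on UNIV f"
| "C_k (Suc k) f \<longleftrightarrow> (\<forall>i. (\<forall>x. has_pd i f x) \<and> C_k k (pd i f))"

definition test_function :: "(real^'n::finite) set \<Rightarrow> (real^'n \<Rightarrow> real) \<Rightarrow> bool" where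
  "test_function \<Omega> \<phi> \<longleftrightarrow>
     (\<forall>k. C_k k \<phi>) \<and> (\<exists>K. compact K \<and> K \<subseteq> \<Omega> \<and> (\<forall>x. x \<notin> K \<longrightarrow> \<phi> x = 0))"

definition laplacian :: "(real^'n::finite \<Rightarrow> real) \<Rightarrow> real^'n \<Rightarrow> real" where
  "laplacian \<phi> x = (\<Sum>i\<in>UNIV. pd i (pd i \<phi>) x)"

text \<open>
  \<open>E\<close> with domain \<open>D\<close> acts as \<open>- a1 * laplacian + a2 * identity\<close> in the sense of
  distributions on \<open>\<Omega>\<close>. The boundary condition is part of the choice of the domain \<open>D\<close>.
\<close>

definition elliptic_operator ::
  "(real^'n::finite) set \<Rightarrow> real \<Rightarrow> real \<Rightarrow> (real^'n) L2 set \<Rightarrow> ((real^'n) L2 \<Rightarrow> (real^'n) L2) \<Rightarrow> bool"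
where
  "elliptic_operator \<Omega> a1 a2 D E \<longleftrightarrow>
     subspace D \<and> D \<subseteq> L2_on \<Omega> \<and> E ` D \<subseteq> L2_on \<Omega> \<and>
     (\<forall>f\<in>D. \<forall>\<phi>. test_function \<Omega> \<phi> \<longrightarrow>
        inner (E f) (L2_of \<Omega> \<phi>) =
        - a1 * inner f (L2_of \<Omega> (laplacian \<phi>)) + a2 * inner f (L2_of \<Omega> \<phi>))"

text \<open>\<open>C\<close> is the inverse of the square of \<open>E\<close>.\<close>

definition inverse_square_of :: "'a set \<Rightarrow> 'a set \<Rightarrow> ('a \<Rightarrow> 'a) \<Rightarrow> ('a \<Rightarrow> 'a) \<Rightarrow> bool" where
  "inverse_square_of X D E C \<longleftrightarrow>
     bij_betw E D X \<and> (\<forall>f\<in>X. C f = the_inv_into D E (the_inv_into D E f))"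


section \<open>Path observations\<close>

definition delta_path ::
  "real \<Rightarrow> (real \<Rightarrow> real^'n \<Rightarrow> real^2) \<Rightarrow> real^2 \<Rightarrow> real \<Rightarrow> real^'n::finite \<Rightarrow> real" where
  "delta_path \<epsilon>x r x t \<xi> =
     exp (- (norm (x - r t \<xi>))\<^sup>2 / (2 * \<epsilon>x)) / (2 * pi * \<epsilon>x)"

definition mollifier :: "real \<Rightarrow> real \<Rightarrow> real \<Rightarrow> real" where
  "mollifier \<epsilon>t s t = exp (- (t - s)\<^sup>2 / (2 * \<epsilon>t)) / sqrt (2 * pi * \<epsilon>t)"


section \<open>Posterior covariance\<close>

text \<open>
  \<open>X\<close> is the parameter space, \<open>F\<close> the parameter-to-observable map, \<open>v\<close> the noise variance and
  \<open>C\<close> the prior covariance, whose inverse has domain \<open>C ` X\<close>.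
\<close>

definition data_hessian ::
  "'a::real_inner set \<Rightarrow> real \<Rightarrow> ('a \<Rightarrow> 'b::real_inner) \<Rightarrow> 'a \<Rightarrow> 'a" where
  "data_hessian X v F f = inverse v *\<^sub>R adjoint_on X F (F f)"

definition hessian ::
  "'a::real_inner set \<Rightarrow> real \<Rightarrow> ('a \<Rightarrow> 'a) \<Rightarrow> ('a \<Rightarrow> 'b::real_inner) \<Rightarrow> 'a \<Rightarrow> 'a" where
  "hessian X v C F f = data_hessian X v F f + the_inv_into X C f"

definition posterior_covariance ::
  "'a::real_inner set \<Rightarrow> real \<Rightarrow> ('a \<Rightarrow> 'a) \<Rightarrow> ('a \<Rightarrow> 'b::real_inner) \<Rightarrow> 'a \<Rightarrow> 'a" where
  "posterior_covariance X v C F = the_inv_into (C ` X) (hessian X v C F)"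

end

theory Submission
  imports Defs
begin

text \<open>
  Let \<open>S\<^sup>*\<close> be the adjoint of the solution operator on \<open>\<M>\<close>. Then \<open>(F \<eta> f)\<^sub>k = \<langle>a\<^sub>k \<eta>, f\<rangle>\<close> with
  \<open>a\<^sub>k \<eta> = S\<^sup>* (\<tau>\<^sub>k \<delta> \<eta>)\<close>, so the data Hessian is the finite rank operator
  \<open>A \<eta> = \<sigma>\<^sup>-\<^sup>2 (\<Sum>k. a\<^sub>k \<eta> \<otimes> a\<^sub>k \<eta>)\<close>. This separates the analysis of the kernel from the operator
  calculus.

  The kernel is differentiable in \<open>L\<^sup>2\<close>: for \<open>t\<close> in the compact inversion interval and \<open>\<eta>\<close> on a
  segment the partial derivative of the path is bounded, so the difference quotients of
  \<open>\<tau>\<^sub>k \<delta>\<close> are bounded by the mean value theorem and converge by dominated convergence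
  (\<open>weighted_path_kernel_has_vector_derivative\<close>). The adjoint \<open>S\<^sup>*\<close> exists by the Riesz
  representation theorem, which needs completeness of \<open>L\<^sup>2\<close> over a bounded set
  (\<open>complete_L2_on\<close>); being bounded and linear, it carries the derivative over to \<open>a\<^sub>k\<close>. The
  product rule for \<open>u \<otimes> u\<close> then differentiates \<open>A\<close> in operator norm
  (\<open>data_hessian_has_operator_pd\<close>).

  The prior precision is unbounded, so the Hessian is studied through the substitution \<open>f = C u\<close>,
  with \<open>C\<close> the prior covariance: the equation \<open>(A \<eta> + C\<^sup>-\<^sup>1) f = g\<close> becomes \<open>A \<eta> (C u) + u = g\<close>.
  It is solvable for every \<open>g\<close> because \<open>A \<eta>\<close> has finite rank (\<open>normal_equation_solvable\<close>), and an
  energy estimate shows that the solution operator \<open>P \<eta>\<close>, the posterior covariance, satisfies every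
  operator bound of \<open>C\<close> (\<open>normal_equation_bound\<close>). The resolvent identity
  \<open>P \<eta> - P \<xi> = - P \<xi> (A \<eta> - A \<xi>) P \<eta>\<close> contains differences of bounded operators only. With the bound
  on \<open>P \<eta>\<close>, uniform in \<open>\<eta>\<close>, it gives first the continuity of \<open>P\<close> and then, divided by the step
  size, the derivative (\<open>posterior_covariance_has_operator_pd\<close>).
\<close>


section \<open>Bounded operators on a subspace\<close>

lemma bounded_operatorD:
  assumes "bounded_operator X Y A"
  shows "f \<in> X \<Longrightarrow> A f \<in> Y"
    and "f \<in> X \<Longrightarrow> g \<in> X \<Longrightarrow> A (f + g) = A f + A g"
    and "f \<in> X \<Longrightarrow> A (c *\<^sub>R f) = c *\<^sub>R A f"
  using assms by (auto simp: bounded_operator_def)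

lemma bounded_operator_diff:
  assumes "bounded_operator X Y A" "subspace X" "f \<in> X" "g \<in> X"
  shows "A (f - g) = A f - A g"
  using bounded_operatorD(2)[OF assms(1), of f "(-1) *\<^sub>R g"]
    bounded_operatorD(3)[OF assms(1), of g "-1"] assms subspace_neg[of X g]
  by simp

lemma bounded_operator_linear_sum:
  assumes "bounded_operator X Y A" "subspace X" "finite I" "\<And>i. i \<in> I \<Longrightarrow> f i \<in> X"
  shows "A (\<Sum>i\<in>I. c i *\<^sub>R f i) = (\<Sum>i\<in>I. c i *\<^sub>R A (f i))"
  using assms(3,4)
proof (induction I rule: finite_induct)
  case empty
  have "A (0 *\<^sub>R 0) = 0 *\<^sub>R A 0"
    using bounded_operatorD(3)[OF assms(1)] subspace_0[OF assms(2)] by blast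
  then show ?case by simp
next
  case (insert i I)
  then have "c i *\<^sub>R f i \<in> X" "(\<Sum>i\<in>I. c i *\<^sub>R f i) \<in> X"
    using assms(2) by (auto intro!: subspace_sum subspace_scale)
  with insert show ?case
    by (simp add: bounded_operatorD(2,3)[OF assms(1)])
qed

lemma bounded_operator_bound:
  assumes "bounded_operator X Y A"
  obtains K where "K > 0" "\<And>f. f \<in> X \<Longrightarrow> norm (A f) \<le> K * norm f"
proof -
  obtain K where K: "\<forall>f\<in>X. norm (A f) \<le> K * norm f"
    using assms by (auto simp: bounded_operator_def)
  have "norm (A f) \<le> (\<bar>K\<bar> + 1) * norm f" if "f \<in> X" for f
  proof -
    have "K * norm f \<le> (\<bar>K\<bar> + 1) * norm f"
      by (rule mult_right_mono) auto
    with K that show ?thesis by fastforce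
  qed
  then show ?thesis
    using that[of "\<bar>K\<bar> + 1"] by auto
qed

lemma bounded_operator_compose:
  assumes A: "bounded_operator X Y A" and B: "bounded_operator Y Z B"
  shows "bounded_operator X Z (\<lambda>f. B (A f))"
proof -
  obtain K where K: "K > 0" "\<And>f. f \<in> X \<Longrightarrow> norm (A f) \<le> K * norm f"
    using bounded_operator_bound[OF A] by blast
  obtain L where L: "L > 0" "\<And>f. f \<in> Y \<Longrightarrow> norm (B f) \<le> L * norm f"
    using bounded_operator_bound[OF B] by blast
  have "norm (B (A f)) \<le> (L * K) * norm f" if "f \<in> X" for f
  proof -
    have "norm (B (A f)) \<le> L * norm (A f)"
      using L that bounded_operatorD(1)[OF A] by blast
    also have "\<dots> \<le> L * (K * norm f)"
      using L K that by (intro mult_left_mono) auto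
    finally show ?thesis by (simp add: mult.assoc)
  qed
  then show ?thesis
    unfolding bounded_operator_def
    using bounded_operatorD[OF A] bounded_operatorD[OF B] by (auto intro!: exI[of _ "L * K"])
qed

lemma bounded_operator_zero: "subspace Y \<Longrightarrow> bounded_operator X Y (\<lambda>_. 0)"
  by (auto simp: bounded_operator_def subspace_0 intro!: exI[of _ 0])

lemma bounded_operator_add:
  assumes A: "bounded_operator X Y A" and B: "bounded_operator X Y B" and Y: "subspace Y"
  shows "bounded_operator X Y (\<lambda>f. A f + B f)"
proof -
  obtain K where K: "K > 0" "\<And>f. f \<in> X \<Longrightarrow> norm (A f) \<le> K * norm f"
    using bounded_operator_bound[OF A] by blast
  obtain L where L: "L > 0" "\<And>f. f \<in> X \<Longrightarrow> norm (B f) \<le> L * norm f"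
    using bounded_operator_bound[OF B] by blast
  have "norm (A f + B f) \<le> (K + L) * norm f" if "f \<in> X" for f
    using norm_triangle_ineq[of "A f" "B f"] K(2)[OF that] L(2)[OF that]
    by (simp add: distrib_right)
  then show ?thesis
    unfolding bounded_operator_def
    using bounded_operatorD[OF A] bounded_operatorD[OF B] subspace_add[OF Y]
    by (auto simp: scaleR_add_right intro!: exI[of _ "K + L"])
qed

lemma bounded_operator_scaleR:
  assumes A: "bounded_operator X Y A" and Y: "subspace Y"
  shows "bounded_operator X Y (\<lambda>f. c *\<^sub>R A f)"
proof -
  obtain K where K: "K > 0" "\<And>f. f \<in> X \<Longrightarrow> norm (A f) \<le> K * norm f"
    using bounded_operator_bound[OF A] by blast
  have "norm (c *\<^sub>R A f) \<le> (\<bar>c\<bar> * K) * norm f" if "f \<in> X" for f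
    using mult_left_mono[OF K(2)[OF that], of "\<bar>c\<bar>"] by (simp add: mult.assoc)
  then show ?thesis
    unfolding bounded_operator_def
    using bounded_operatorD[OF A] subspace_scale[OF Y]
    by (auto simp: scaleR_add_right mult.commute intro!: exI[of _ "\<bar>c\<bar> * K"])
qed

lemma bounded_operator_minus:
  assumes "bounded_operator X Y A" "bounded_operator X Y B" "subspace Y"
  shows "bounded_operator X Y (\<lambda>f. A f - B f)"
  using bounded_operator_add[OF assms(1) bounded_operator_scaleR[OF assms(2,3), of "-1"] assms(3)]
  by simp

lemma bounded_operator_sum:
  assumes "\<And>i. i \<in> I \<Longrightarrow> bounded_operator X Y (A i)" "subspace Y"
  shows "bounded_operator X Y (\<lambda>f. \<Sum>i\<in>I. A i f)"
  using assms(1)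
proof (induction I rule: infinite_finite_induct)
  case (insert i I)
  then show ?case
    using bounded_operator_add[of X Y "A i" "\<lambda>f. \<Sum>i\<in>I. A i f"] assms(2) by simp
qed (simp_all add: bounded_operator_zero assms(2))

lemma bounded_operator_tensor:
  assumes "u \<in> Y" "subspace Y"
  shows "bounded_operator X Y (tensor u v)"
proof -
  have "norm (tensor u v f) \<le> (norm v * norm u) * norm f" for f
    using mult_right_mono[OF Cauchy_Schwarz_ineq2[of v f], of "norm u"]
    by (simp add: tensor_def mult.assoc mult.left_commute mult.commute)
  then show ?thesis
    unfolding bounded_operator_def
    using assms by (auto simp: tensor_def subspace_scale inner_add_right scaleR_add_left)
qed

lemma bounded_operator_cong:
  assumes "bounded_operator X Y A" "subspace X" "\<And>f. f \<in> X \<Longrightarrow> A f = B f"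
  shows "bounded_operator X Y B"
proof -
  have "f + g \<in> X" "c *\<^sub>R f \<in> X" if "f \<in> X" "g \<in> X" for f g c
    using that assms(2) by (auto simp: subspace_add subspace_scale)
  then show ?thesis
    using assms(1,3) unfolding bounded_operator_def by (simp add: image_subset_iff)
qed

text \<open>
  Division by zero makes the quotient at \<open>f = 0\<close> equal to \<open>0\<close>. Hence the supremum is nonnegative,
  and an operator bound need not be tested separately at \<open>0\<close>.
\<close>

lemma onorm_on_le:
  assumes "0 \<in> X" "0 \<le> K" "\<And>f. f \<in> X \<Longrightarrow> norm (A f) \<le> K * norm f"
  shows "0 \<le> onorm_on X A" "onorm_on X A \<le> K"
proof -
  have le: "norm (A f) / norm f \<le> K" if "f \<in> X" for f
    using assms(2) assms(3)[OF that] by (cases "f = 0") (auto simp: divide_le_eq)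
  show "onorm_on X A \<le> K"
    unfolding onorm_on_def using assms(1) le by (intro cSUP_least) auto
  have "norm (A 0) / norm (0::'a) \<le> onorm_on X A"
    unfolding onorm_on_def using assms(1) le by (intro cSUP_upper) (auto simp: bdd_above_def)
  then show "0 \<le> onorm_on X A" by simp
qed

lemma norm_le_onorm_on:
  assumes "bounded_operator X Y A" "f \<in> X"
  shows "norm (A f) \<le> onorm_on X A * norm f"
proof -
  obtain K where K: "K > 0" "\<And>f. f \<in> X \<Longrightarrow> norm (A f) \<le> K * norm f"
    using bounded_operator_bound[OF assms(1)] by blast
  have le: "norm (A f) / norm f \<le> K" if "f \<in> X" for f
    using K(1) K(2)[OF that] by (cases "f = 0") (auto simp: divide_le_eq)
  have "norm (A f) / norm f \<le> onorm_on X A"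
    unfolding onorm_on_def using assms(2) le by (intro cSUP_upper) (auto simp: bdd_above_def)
  then show ?thesis
    using K(2)[OF assms(2)] by (cases "f = 0") (auto simp: divide_le_eq)
qed


section \<open>Derivatives in operator norm\<close>

text \<open>
  An operator bound \<open>\<epsilon> h \<rightarrow> 0\<close> on the remainder of the difference quotient is equivalent to the limit
  in the definition; the next two lemmas move between the supremum and pointwise estimates.
\<close>

lemma has_operator_pdI:
  assumes "subspace X" "\<And>\<eta>. bounded_operator X X (A \<eta>)" "bounded_operator X X D"
    and \<epsilon>: "(\<epsilon> \<longlongrightarrow> 0) (at 0)"
    and le: "\<forall>\<^sub>F h in at 0. \<forall>f\<in>X.
      norm ((A (\<xi> + h *\<^sub>R axis j 1) f - A \<xi> f) /\<^sub>R h - D f) \<le> \<epsilon> h * norm f"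
  shows "has_operator_pd X j A D \<xi>"
proof -
  let ?Q = "\<lambda>h f. (A (\<xi> + h *\<^sub>R axis j 1) f - A \<xi> f) /\<^sub>R h - D f"
  have *: "\<forall>\<^sub>F h in at 0. 0 \<le> onorm_on X (?Q h) \<and> onorm_on X (?Q h) \<le> \<bar>\<epsilon> h\<bar>"
    using le
  proof eventually_elim
    case (elim h)
    have "norm (?Q h f) \<le> \<bar>\<epsilon> h\<bar> * norm f" if "f \<in> X" for f
    proof -
      have "\<epsilon> h * norm f \<le> \<bar>\<epsilon> h\<bar> * norm f"
        by (rule mult_right_mono) auto
      with elim that show ?thesis by fastforce
    qed
    then show ?case
      using onorm_on_le[of X "\<bar>\<epsilon> h\<bar>" "?Q h"] subspace_0[OF assms(1)] by simp
  qed
  have "((\<lambda>h. onorm_on X (?Q h)) \<longlongrightarrow> 0) (at 0)"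
    by (rule tendsto_sandwich[OF _ _ tendsto_const tendsto_rabs_zero[OF \<epsilon>]])
      (use * in \<open>auto elim: eventually_mono\<close>)
  with assms(2,3) show ?thesis
    by (simp add: has_operator_pd_def)
qed

lemma has_operator_pdD:
  assumes "has_operator_pd X j A D \<xi>" "subspace X"
  obtains \<epsilon> where "(\<epsilon> \<longlongrightarrow> 0) (at 0)"
    "\<And>h f. f \<in> X \<Longrightarrow>
      norm ((A (\<xi> + h *\<^sub>R axis j 1) f - A \<xi> f) /\<^sub>R h - D f) \<le> \<epsilon> h * norm f"
proof
  let ?Q = "\<lambda>h f. (A (\<xi> + h *\<^sub>R axis j 1) f - A \<xi> f) /\<^sub>R h - D f"
  show "((\<lambda>h. onorm_on X (?Q h)) \<longlongrightarrow> 0) (at 0)"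
    using assms(1) by (simp add: has_operator_pd_def)
  fix h f assume "f \<in> X"
  moreover have "bounded_operator X X (?Q h)"
    using assms by (intro bounded_operator_minus bounded_operator_scaleR)
      (auto simp: has_operator_pd_def)
  ultimately show "norm (?Q h f) \<le> onorm_on X (?Q h) * norm f"
    by (rule norm_le_onorm_on[rotated])
qed

lemma has_vector_derivative_at_0_iff:
  "(f has_vector_derivative f') (at 0) \<longleftrightarrow> ((\<lambda>h. (f h - f 0) /\<^sub>R h) \<longlongrightarrow> f') (at 0)"
proof -
  have eq: "norm (f h - f 0 - (h - 0) *\<^sub>R f') / norm (h - 0) = norm ((f h - f 0) /\<^sub>R h - f')"
    if "h \<noteq> 0" for h
  proof -
    have "(f h - f 0) /\<^sub>R h - f' = inverse h *\<^sub>R (f h - f 0 - (h - 0) *\<^sub>R f')"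
      using that by (simp add: scaleR_diff_right)
    then show ?thesis by (simp add: divide_inverse mult.commute)
  qed
  have "(f has_vector_derivative f') (at 0) \<longleftrightarrow>
      ((\<lambda>h. norm (f h - f 0 - (h - 0) *\<^sub>R f') / norm (h - 0)) \<longlongrightarrow> 0) (at 0)"
    by (simp add: has_vector_derivative_def has_derivative_iff_norm bounded_linear_scaleR_left)
  also have "\<dots> \<longleftrightarrow> ((\<lambda>h. norm ((f h - f 0) /\<^sub>R h - f')) \<longlongrightarrow> 0) (at 0)"
    by (rule filterlim_cong) (auto simp: eventually_at_filter intro!: always_eventually dest!: eq)
  also have "\<dots> \<longleftrightarrow> ((\<lambda>h. (f h - f 0) /\<^sub>R h) \<longlongrightarrow> f') (at 0)"
    by (simp add: tendsto_norm_zero_iff LIM_zero_iff)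
  finally show ?thesis .
qed


section \<open>Riesz representation and adjoints\<close>

text \<open>
  The representing element minimises \<open>\<parallel>f\<parallel>\<^sup>2 - 2 l f\<close> over \<open>X\<close>. By the parallelogram identity every
  minimising sequence is Cauchy, and the first variation vanishes at its limit.
\<close>

lemma Riesz_representation_on:
  fixes l :: "'a::real_inner \<Rightarrow> real"
  assumes X: "subspace X" "complete X" and l: "bounded_operator X UNIV l"
  shows "\<exists>f\<in>X. \<forall>g\<in>X. l g = inner g f"
proof -
  define J where "J f = inner f f - 2 * l f" for f
  obtain K where K: "K > 0" "\<And>f. f \<in> X \<Longrightarrow> norm (l f) \<le> K * norm f"
    using bounded_operator_bound[OF l] by blast
  note lin = bounded_operatorD(2,3)[OF l]
  have lower: "- (K\<^sup>2) \<le> J f" if "f \<in> X" for f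
  proof -
    have "0 \<le> (norm f - K)\<^sup>2" by simp
    moreover have "l f \<le> K * norm f" using K(2)[OF that] by simp
    ultimately show ?thesis
      by (simp add: J_def power2_diff power2_norm_eq_inner mult.commute)
  qed
  define m where "m = (INF f\<in>X. J f)"
  have bdd: "bdd_below (J ` X)" using lower by (intro bdd_belowI2)
  have ne: "X \<noteq> {}" using subspace_0[OF X(1)] by auto
  have m_le: "m \<le> J f" if "f \<in> X" for f
    unfolding m_def using bdd that by (rule cINF_lower)
  have "\<exists>f\<in>X. J f < m + inverse (real (Suc n))" for n
  proof -
    have "(INF f\<in>X. J f) < m + inverse (real (Suc n))" by (simp add: m_def)
    then show ?thesis by (subst (asm) cINF_less_iff[OF ne bdd])
  qed
  then obtain s where s: "\<And>n. s n \<in> X" "\<And>n. J (s n) < m + inverse (real (Suc n))"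
    by metis
  have par: "(norm (f - g))\<^sup>2 \<le> 2 * (J f - m) + 2 * (J g - m)" if "f \<in> X" "g \<in> X" for f g
  proof -
    have mem: "(1/2) *\<^sub>R f \<in> X" "(1/2) *\<^sub>R g \<in> X" using X that by (auto intro: subspace_scale)
    then have "m \<le> J ((1/2) *\<^sub>R f + (1/2) *\<^sub>R g)" using X by (intro m_le subspace_add)
    also have "\<dots> = (inner f f + 2 * inner f g + inner g g) / 4 - l f - l g"
      using mem that by (simp add: J_def lin inner_add inner_commute[of g f] field_simps)
    finally show ?thesis
      by (simp add: J_def power2_norm_eq_inner inner_diff inner_commute[of g f] field_simps)
  qed
  have "Cauchy s"
  proof (rule CauchyI)
    fix e :: real assume e: "e > 0"
    then obtain N where N: "inverse (real (Suc N)) < e\<^sup>2 / 4"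
      using reals_Archimedean[of "e\<^sup>2 / 4"] by auto
    have "norm (s i - s j) < e" if "i \<ge> N" "j \<ge> N" for i j
    proof -
      have near: "J (s n) - m < e\<^sup>2 / 4" if "n \<ge> N" for n
      proof -
        have "inverse (real (Suc n)) \<le> inverse (real (Suc N))" using that by auto
        with s(2)[of n] N show ?thesis by (smt (verit))
      qed
      have "(norm (s i - s j))\<^sup>2 < e\<^sup>2"
        using par[OF s(1)[of i] s(1)[of j]] near[OF that(1)] near[OF that(2)] by argo
      then show ?thesis using e by (rule power2_less_imp_less[OF _ less_imp_le])
    qed
    then show "\<exists>M. \<forall>m\<ge>M. \<forall>n\<ge>M. norm (s m - s n) < e" by blast
  qed
  then obtain f where f: "f \<in> X" "s \<longlonglongrightarrow> f"
    using X(2) s(1) unfolding complete_def by blast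
  have "(\<lambda>n. l (s n)) \<longlonglongrightarrow> l f"
  proof (rule Lim_null_comparison[THEN LIM_zero_cancel])
    show "\<forall>\<^sub>F n in sequentially. norm (l (s n) - l f) \<le> K * norm (s n - f)"
      using K(2)[OF subspace_diff[OF X(1) s(1) f(1)]] bounded_operator_diff[OF l X(1) s(1) f(1)]
      by simp
    show "(\<lambda>n. K * norm (s n - f)) \<longlonglongrightarrow> 0"
      by (rule tendsto_mult_right_zero) (use f(2) in \<open>simp add: tendsto_norm_zero LIM_zero\<close>)
  qed
  then have "(\<lambda>n. J (s n)) \<longlonglongrightarrow> J f"
    unfolding J_def by (intro tendsto_intros f(2))
  moreover have "(\<lambda>n. m + inverse (real (Suc n))) \<longlonglongrightarrow> m + 0"
    by (intro tendsto_add tendsto_const LIMSEQ_inverse_real_of_nat)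
  ultimately have "J f \<le> m"
    using s(2) by (intro LIMSEQ_le[of "\<lambda>n. J (s n)" "J f" "\<lambda>n. m + inverse (real (Suc n))" m])
      (auto intro: less_imp_le)
  have "l g = inner g f" if g: "g \<in> X" for g
  proof (rule ccontr)
    assume "l g \<noteq> inner g f"
    define d where "d = inner g f - l g"
    have d: "d \<noteq> 0" using \<open>l g \<noteq> inner g f\<close> by (simp add: d_def)
    have var: "0 \<le> 2 * t * d + t\<^sup>2 * inner g g" for t
    proof -
      have "J f \<le> J (f + t *\<^sub>R g)"
        using \<open>J f \<le> m\<close> m_le[of "f + t *\<^sub>R g"] X f g by (auto simp: subspace_add subspace_scale)
      also have "\<dots> = J f + 2 * t * d + t\<^sup>2 * inner g g"
        using f g X by (simp add: J_def d_def lin subspace_scale inner_add inner_commute[of f g]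
            power2_eq_square algebra_simps)
      finally show ?thesis by simp
    qed
    have pos: "inner g g + 1 > 0" "inner g g + 2 > 0" using inner_ge_zero[of g] by linarith+
    \<comment> \<open>The quadratic is minimal, up to the shift that keeps the denominator positive, here:\<close>
    define t where "t = - d / (inner g g + 1)"
    have "2 * t * d + t\<^sup>2 * inner g g = - (d\<^sup>2) * (inner g g + 2) / (inner g g + 1)\<^sup>2"
      using pos(1) unfolding t_def by (simp add: power2_eq_square divide_simps) (simp add: algebra_simps)
    also have "\<dots> < 0"
      using d pos by (intro divide_neg_pos mult_neg_pos zero_less_power) auto
    finally show False using var[of t] by simp
  qed
  with f show ?thesis by blast
qed

lemma adjoint_on_eqI:
  assumes "subspace X" "f \<in> X" "\<And>g. g \<in> X \<Longrightarrow> inner (A g) v = inner g f"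
  shows "adjoint_on X A v = f"
  unfolding adjoint_on_def
proof (rule the_equality)
  fix f' assume f': "f' \<in> X \<and> (\<forall>g\<in>X. inner (A g) v = inner g f')"
  then have "f' - f \<in> X" using assms by (auto simp: subspace_diff)
  then have "inner (f' - f) (f' - f) = 0"
    using f' assms(3) by (simp add: inner_diff_right)
  then show "f' = f" by simp
qed (use assms in auto)

lemma adjoint_on:
  assumes X: "subspace X" "complete X" and A: "bounded_operator X Y A"
  shows "adjoint_on X A v \<in> X" "g \<in> X \<Longrightarrow> inner (A g) v = inner g (adjoint_on X A v)"
proof -
  obtain K where K: "K > 0" "\<And>f. f \<in> X \<Longrightarrow> norm (A f) \<le> K * norm f"
    using bounded_operator_bound[OF A] by blast
  have "norm (inner (A f) v) \<le> (K * norm v) * norm f" if "f \<in> X" for f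
    using Cauchy_Schwarz_ineq2[of "A f" v] mult_right_mono[OF K(2)[OF that], of "norm v"]
    by (simp add: mult.assoc mult.commute[of "norm f"])
  then have "bounded_operator X UNIV (\<lambda>f. inner (A f) v)"
    unfolding bounded_operator_def using bounded_operatorD[OF A]
    by (auto simp: inner_add_left)
  from Riesz_representation_on[OF X this]
  obtain f where f: "f \<in> X" "\<And>g. g \<in> X \<Longrightarrow> inner (A g) v = inner g f"
    by blast
  with adjoint_on_eqI[OF X(1), of f A v]
  show "adjoint_on X A v \<in> X" "g \<in> X \<Longrightarrow> inner (A g) v = inner g (adjoint_on X A v)"
    by auto
qed

lemma bounded_linear_adjoint_on:
  fixes A :: "'a::real_inner \<Rightarrow> 'b::real_inner"
  assumes X: "subspace X" "complete X" and A: "bounded_operator X Y A"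
  shows "bounded_linear (adjoint_on X A)"
proof -
  note adj = adjoint_on[OF X A]
  obtain K where K: "K > 0" "\<And>f. f \<in> X \<Longrightarrow> norm (A f) \<le> K * norm f"
    using bounded_operator_bound[OF A] by blast
  show ?thesis
  proof (rule bounded_linear_intro[where K = K])
    show "adjoint_on X A (u + v) = adjoint_on X A u + adjoint_on X A v" for u v
      using adj X(1) by (intro adjoint_on_eqI) (auto simp: subspace_add inner_add_right)
    show "adjoint_on X A (c *\<^sub>R v) = c *\<^sub>R adjoint_on X A v" for c v
      using adj X(1) by (intro adjoint_on_eqI) (auto simp: subspace_scale)
    show "norm (adjoint_on X A v) \<le> norm v * K" for v
    proof -
      let ?f = "adjoint_on X A v"
      have "(norm ?f)\<^sup>2 = inner (A ?f) v"
        using adj(2)[OF adj(1), of v v] by (simp add: power2_norm_eq_inner)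
      also have "\<dots> \<le> norm (A ?f) * norm v" by (rule norm_cauchy_schwarz)
      also have "\<dots> \<le> (K * norm ?f) * norm v"
        using K(2)[OF adj(1)] by (intro mult_right_mono) auto
      finally have "norm ?f * norm ?f \<le> norm ?f * (norm v * K)"
        by (simp add: power2_eq_square mult.assoc mult.left_commute mult.commute)
      then show ?thesis using K(1) by (cases "?f = 0") auto
    qed
  qed
qed


section \<open>Differentiating the posterior covariance\<close>

text \<open>
  The observables are represented by finitely many vectors \<open>a k\<close>; this is what gives the data
  Hessian finite rank and keeps its formula free of adjoints.
\<close>

locale linear_bayes =
  fixes X :: "'a::real_inner set" and C :: "'a \<Rightarrow> 'a" and v :: real
    and a :: "'m::finite \<Rightarrow> 'a" and F :: "'a \<Rightarrow> real^'m"
  assumes X: "subspace X"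
    and C: "bounded_operator X X C" "self_adjoint_on X C" "strictly_positive_on X C"
    and v: "v > 0"
    and a: "\<And>k. a k \<in> X"
    and F: "\<And>f. f \<in> X \<Longrightarrow> F f = (\<chi> k. inner (a k) f)"
begin

lemma C_nonneg: "f \<in> X \<Longrightarrow> 0 \<le> inner (C f) f"
  using C(3) by (cases "f = 0") (auto simp: strictly_positive_on_def less_imp_le)

lemma C_eq_0D: "f \<in> X \<Longrightarrow> inner (C f) f \<le> 0 \<Longrightarrow> f = 0"
  using C(3) by (fastforce simp: strictly_positive_on_def)

lemma data_hessian_eq:
  assumes f: "f \<in> X"
  shows "data_hessian X v F f = inverse v *\<^sub>R (\<Sum>k\<in>UNIV. tensor (a k) (a k) f)"
proof -
  have "adjoint_on X F (F f) = (\<Sum>k\<in>UNIV. inner (a k) f *\<^sub>R a k)"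
  proof (rule adjoint_on_eqI[OF X])
    show "(\<Sum>k\<in>UNIV. inner (a k) f *\<^sub>R a k) \<in> X"
      using X a by (intro subspace_sum subspace_scale)
    fix g assume "g \<in> X"
    then show "inner (F g) (F f) = inner g (\<Sum>k\<in>UNIV. inner (a k) f *\<^sub>R a k)"
      using f by (simp add: F inner_vec_def inner_sum_right inner_commute[of g] mult.commute)
  qed
  then show ?thesis by (simp add: data_hessian_def tensor_def)
qed

lemma bounded_operator_data_hessian: "bounded_operator X X (data_hessian X v F)"
proof (rule bounded_operator_cong[OF _ X data_hessian_eq[symmetric]])
  show "bounded_operator X X (\<lambda>f. inverse v *\<^sub>R (\<Sum>k\<in>UNIV. tensor (a k) (a k) f))"
    by (intro bounded_operator_scaleR bounded_operator_sum bounded_operator_tensor X a)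
qed

lemma data_hessian_nonneg: "f \<in> X \<Longrightarrow> 0 \<le> inner (data_hessian X v F f) f"
  using v by (simp add: data_hessian_eq tensor_def inner_sum_left sum_nonneg)

text \<open>
  Writing \<open>f = C u\<close> turns the equation \<open>H f = g\<close> for the Hessian with its unbounded part into
  \<open>A (C u) + u = g\<close>, with \<open>A\<close> of finite rank. Its solutions have the form
  \<open>u = g - (\<Sum>k. c k a k) / v\<close>, where \<open>c\<close> solves a linear system whose matrix is the identity
  plus a positive semidefinite Gram matrix.
\<close>

lemma normal_equation_solvable:
  assumes g: "g \<in> X"
  shows "\<exists>u\<in>X. data_hessian X v F (C u) + u = g"
proof -
  define w where "w c = (\<Sum>l\<in>UNIV. (c $ l) *\<^sub>R a l)" for c :: "real^'m"
  have w: "w c \<in> X" for c unfolding w_def using X a by (intro subspace_sum subspace_scale)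
  have Cw: "C (w c) = (\<Sum>l\<in>UNIV. (c $ l) *\<^sub>R C (a l))" for c
    unfolding w_def using C(1) X a by (intro bounded_operator_linear_sum) auto
  define L where "L c = c + (\<chi> k. inverse v * inner (a k) (C (w c)))" for c
  have "linear L"
    by (rule linearI)
      (simp_all add: L_def Cw vec_eq_iff inner_sum_right distrib_left distrib_right
        sum.distrib sum_distrib_left mult.assoc mult.left_commute)
  have "inj L"
    unfolding linear_injective_0[OF \<open>linear L\<close>]
  proof (intro allI impI)
    fix c assume "L c = 0"
    have "inner (w c) (C (w c)) = (\<Sum>k\<in>UNIV. c $ k * inner (a k) (C (w c)))"
      by (subst (1) w_def) (simp add: inner_sum_left)
    then have "inner c (L c) = inner c c + inverse v * inner (C (w c)) (w c)"
      by (simp add: L_def inner_add_right inner_commute[of "C (w c)"])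
        (simp add: inner_vec_def sum_distrib_left mult.left_commute)
    with \<open>L c = 0\<close> C_nonneg[OF w, of c] v have "inner c c \<le> 0"
      by (simp add: add_nonneg_eq_0_iff)
    then show "c = 0" using inner_ge_zero[of c] by (metis antisym inner_eq_zero_iff)
  qed
  then have "surj L" using \<open>linear L\<close> by (simp add: linear_injective_imp_surjective)
  then obtain c where c: "L c = (\<chi> k. inner (a k) (C g))"
    by (metis surjE)
  define u where "u = g - inverse v *\<^sub>R w c"
  have u: "u \<in> X" unfolding u_def using X g w by (intro subspace_diff subspace_scale)
  have "C u = C g - inverse v *\<^sub>R C (w c)"
    unfolding u_def using X g w
    by (simp add: bounded_operator_diff[OF C(1)] bounded_operatorD(3)[OF C(1)] subspace_scale)
  then have "inner (a k) (C u) = c $ k" for k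
    using arg_cong[OF c, of "\<lambda>x. x $ k"] by (simp add: L_def inner_diff_right)
  then have "data_hessian X v F (C u) = inverse v *\<^sub>R w c"
    using data_hessian_eq[OF bounded_operatorD(1)[OF C(1) u]] by (simp add: tensor_def w_def)
  then have "data_hessian X v F (C u) + u = g" by (simp add: u_def)
  then show ?thesis using u by blast
qed

text \<open>
  The data term is nonnegative and can be dropped from the energy identity, so the posterior
  covariance obeys every operator bound \<open>K\<close> of the prior one. The bound does not see \<open>F\<close>, which
  makes it uniform in the path parameter.
\<close>

lemma normal_equation_bound:
  assumes K: "K > 0" "\<And>f. f \<in> X \<Longrightarrow> norm (C f) \<le> K * norm f"
    and u: "u \<in> X" and g: "g \<in> X" and eq: "data_hessian X v F (C u) + u = g"
  shows "norm (C u) \<le> K * norm g"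
proof -
  have Cu: "C u \<in> X" using bounded_operatorD(1)[OF C(1) u] .
  have sym: "inner (C f) h = inner (C h) f" if "f \<in> X" "h \<in> X" for f h
    using C(2) that by (simp add: self_adjoint_on_def inner_commute)
  have quad: "0 \<le> inner (C f) f - 2 * s * inner (C f) h + s\<^sup>2 * inner (C h) h"
    if "f \<in> X" "h \<in> X" for f h s
  proof -
    have sh: "s *\<^sub>R h \<in> X" using X that by (simp add: subspace_scale)
    have "0 \<le> inner (C (f - s *\<^sub>R h)) (f - s *\<^sub>R h)"
      using X that sh by (intro C_nonneg subspace_diff)
    also have "\<dots> = inner (C f) f - 2 * s * inner (C f) h + s\<^sup>2 * inner (C h) h"
      using that sh X sym[of h f]
      by (simp add: bounded_operator_diff[OF C(1)] bounded_operatorD(3)[OF C(1)] inner_diff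
          power2_eq_square algebra_simps)
    finally show ?thesis .
  qed
  have form: "inner (C f) f \<le> K * (norm f)\<^sup>2" if "f \<in> X" for f
    using norm_cauchy_schwarz[of "C f" f] mult_right_mono[OF K(2)[OF that], of "norm f"]
    by (simp add: power2_eq_square mult.assoc)
  have "inner g (C u) = inner (data_hessian X v F (C u)) (C u) + inner (C u) u"
    by (simp add: eq[symmetric] inner_add_left inner_commute[of u])
  then have "inner (C u) u \<le> inner (C u) g"
    using data_hessian_nonneg[OF Cu] by (simp add: inner_commute[of g])
  \<comment> \<open>Positivity of \<open>C\<close> at \<open>u - g\<close> absorbs the mixed term.\<close>
  with quad[OF u g, of 1] have "inner (C u) u \<le> inner (C g) g" by simp
  also have "\<dots> \<le> K * (norm g)\<^sup>2" by (rule form[OF g])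
  finally have Cuu: "inner (C u) u \<le> K * (norm g)\<^sup>2" .
  \<comment> \<open>Positivity of \<open>C\<close> at \<open>u - C u / K\<close> turns the bound on the form into one on the norm.\<close>
  have "0 \<le> inner (C u) u - 2 * inverse K * (norm (C u))\<^sup>2 + (inverse K)\<^sup>2 * inner (C (C u)) (C u)"
    using quad[OF u Cu, of "inverse K"] by (simp add: power2_norm_eq_inner)
  moreover have "(inverse K)\<^sup>2 * inner (C (C u)) (C u) \<le> (inverse K)\<^sup>2 * (K * (norm (C u))\<^sup>2)"
    using form[OF Cu] by (intro mult_left_mono) auto
  moreover have "(inverse K)\<^sup>2 * (K * (norm (C u))\<^sup>2) = inverse K * (norm (C u))\<^sup>2"
    using K(1) by (simp add: power2_eq_square field_simps)
  ultimately have "inverse K * (norm (C u))\<^sup>2 \<le> K * (norm g)\<^sup>2"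
    using Cuu by linarith
  then have "K * (inverse K * (norm (C u))\<^sup>2) \<le> K * (K * (norm g)\<^sup>2)"
    using K(1) by (intro mult_left_mono) auto
  moreover have "K * (inverse K * (norm (C u))\<^sup>2) = (norm (C u))\<^sup>2"
    using K(1) by simp
  moreover have "K * (K * (norm g)\<^sup>2) = (K * norm g)\<^sup>2"
    by (simp add: power2_eq_square)
  ultimately have "(norm (C u))\<^sup>2 \<le> (K * norm g)\<^sup>2" by simp
  then show ?thesis by (rule power2_le_imp_le) (use K(1) in simp)
qed

lemma inj_on_C: "inj_on C X"
proof (rule inj_onI)
  fix f g assume fg: "f \<in> X" "g \<in> X" "C f = C g"
  then have "C (f - g) = 0" using X by (simp add: bounded_operator_diff[OF C(1)])
  then show "f = g" using C_eq_0D[of "f - g"] fg X by (simp add: subspace_diff)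
qed

lemma posterior_covariance_eq:
  assumes u: "u \<in> X"
  shows "posterior_covariance X v C F (data_hessian X v F (C u) + u) = C u"
proof -
  note A = bounded_operator_data_hessian
  have H: "hessian X v C F (C f) = data_hessian X v F (C f) + f" if "f \<in> X" for f
    using that by (simp add: hessian_def the_inv_into_f_f[OF inj_on_C])
  \<comment> \<open>The bound of the normal equation with right-hand side \<open>0\<close> is uniqueness.\<close>
  have "inj_on (hessian X v C F) (C ` X)"
  proof (rule inj_onI, clarify)
    fix f g assume fg: "f \<in> X" "g \<in> X" "hessian X v C F (C f) = hessian X v C F (C g)"
    have CX: "C f \<in> X" "C g \<in> X" using fg bounded_operatorD(1)[OF C(1)] by auto
    have fgX: "f - g \<in> X" using fg X by (simp add: subspace_diff)
    have eq: "data_hessian X v F (C (f - g)) + (f - g) = 0"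
      using fg X CX by (simp add: H bounded_operator_diff[OF C(1)] bounded_operator_diff[OF A]
          algebra_simps)
    obtain K where K: "K > 0" "\<And>f. f \<in> X \<Longrightarrow> norm (C f) \<le> K * norm f"
      using bounded_operator_bound[OF C(1)] by blast
    have "norm (C (f - g)) \<le> K * norm (0::'a)"
      using K fgX subspace_0[OF X] eq by (rule normal_equation_bound)
    then show "C f = C g"
      using fg X by (simp add: bounded_operator_diff[OF C(1)])
  qed
  then show ?thesis
    unfolding posterior_covariance_def H[OF u, symmetric]
    by (rule the_inv_into_f_f) (rule imageI[OF u])
qed

lemma posterior_covariance_solves:
  assumes "g \<in> X"
  obtains u where "u \<in> X" "data_hessian X v F (C u) + u = g" "posterior_covariance X v C F g = C u"
proof -
  obtain u where u: "u \<in> X" "data_hessian X v F (C u) + u = g"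
    using normal_equation_solvable[OF assms] by blast
  then show ?thesis using that posterior_covariance_eq[OF u(1)] by simp
qed

lemma posterior_covariance_bound:
  assumes "K > 0" "\<And>f. f \<in> X \<Longrightarrow> norm (C f) \<le> K * norm f" and g: "g \<in> X"
  shows "norm (posterior_covariance X v C F g) \<le> K * norm g"
proof -
  obtain u where u: "u \<in> X" "data_hessian X v F (C u) + u = g" "posterior_covariance X v C F g = C u"
    using posterior_covariance_solves[OF g] by blast
  then show ?thesis using normal_equation_bound[OF assms(1,2) u(1) g u(2)] by simp
qed

lemma bounded_operator_posterior_covariance:
  "bounded_operator X X (posterior_covariance X v C F)" (is "bounded_operator X X ?P")
proof -
  let ?A = "data_hessian X v F"
  note A = bounded_operator_data_hessian
  have mem: "?P g \<in> X" if g: "g \<in> X" for g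
  proof -
    obtain u where "u \<in> X" "?P g = C u"
      using posterior_covariance_solves[OF g] by blast
    then show ?thesis by (simp add: bounded_operatorD(1)[OF C(1)])
  qed
  have add: "?P (g + h) = ?P g + ?P h" if gh: "g \<in> X" "h \<in> X" for g h
  proof -
    obtain u where u: "u \<in> X" "?A (C u) + u = g" "?P g = C u"
      using posterior_covariance_solves[OF gh(1)] by blast
    obtain w where w: "w \<in> X" "?A (C w) + w = h" "?P h = C w"
      using posterior_covariance_solves[OF gh(2)] by blast
    have "?A (C (u + w)) + (u + w) = g + h"
      using u w bounded_operatorD[OF C(1)] bounded_operatorD[OF A] by (auto simp: algebra_simps)
    then have "?P (g + h) = C (u + w)"
      using posterior_covariance_eq[of "u + w"] u w X by (simp add: subspace_add)
    then show ?thesis using u w bounded_operatorD(2)[OF C(1)] by simp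
  qed
  have scale: "?P (c *\<^sub>R g) = c *\<^sub>R ?P g" if g: "g \<in> X" for c g
  proof -
    obtain u where u: "u \<in> X" "?A (C u) + u = g" "?P g = C u"
      using posterior_covariance_solves[OF g] by blast
    have "?A (C (c *\<^sub>R u)) + c *\<^sub>R u = c *\<^sub>R g"
      using u bounded_operatorD[OF C(1)] bounded_operatorD[OF A]
      by (auto simp: scaleR_add_right)
    then have "?P (c *\<^sub>R g) = C (c *\<^sub>R u)"
      using posterior_covariance_eq[of "c *\<^sub>R u"] u X by (simp add: subspace_scale)
    then show ?thesis using u bounded_operatorD(3)[OF C(1)] by simp
  qed
  obtain K where K: "K > 0" "\<And>f. f \<in> X \<Longrightarrow> norm (C f) \<le> K * norm f"
    using bounded_operator_bound[OF C(1)] by blast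
  with mem add scale posterior_covariance_bound[OF K] show ?thesis
    unfolding bounded_operator_def by (auto intro!: exI[of _ K])
qed

end

text \<open>
  The second resolvent identity. Both Hessians have the domain \<open>C ` X\<close> and the same unbounded part,
  which cancels in their difference.
\<close>

lemma posterior_covariance_resolvent:
  assumes "linear_bayes X C v a F" "linear_bayes X C v b G" and g: "g \<in> X"
  shows "posterior_covariance X v C G g - posterior_covariance X v C F g =
    - posterior_covariance X v C F
        (data_hessian X v G (posterior_covariance X v C G g) -
         data_hessian X v F (posterior_covariance X v C G g))"
proof -
  interpret F: linear_bayes X C v a F by fact
  interpret G: linear_bayes X C v b G by fact
  let ?PF = "posterior_covariance X v C F" and ?PG = "posterior_covariance X v C G"
  obtain u where u: "u \<in> X" "data_hessian X v G (C u) + u = g" "?PG g = C u"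
    using G.posterior_covariance_solves[OF g] by blast
  let ?d = "data_hessian X v G (C u) - data_hessian X v F (C u)"
  have CuX: "C u \<in> X" using u bounded_operatorD(1)[OF F.C(1)] by blast
  have d: "?d \<in> X"
    using CuX bounded_operatorD(1)[OF F.bounded_operator_data_hessian]
      bounded_operatorD(1)[OF G.bounded_operator_data_hessian] F.X by (auto intro: subspace_diff)
  have "C u = ?PF (data_hessian X v F (C u) + u)"
    using F.posterior_covariance_eq[OF u(1)] by simp
  also have "data_hessian X v F (C u) + u = g - ?d"
    using u(2) by (simp add: algebra_simps)
  also have "?PF (g - ?d) = ?PF g - ?PF ?d"
    using bounded_operator_diff[OF F.bounded_operator_posterior_covariance F.X g d] .
  finally have "C u = ?PF g - ?PF ?d" .
  moreover have "x - y = - z" if "x = y - z" for x y z :: 'a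
    using that by simp
  ultimately show ?thesis unfolding u(3) by blast
qed

text \<open>
  With \<open>p = a (\<xi> + h)\<close> and \<open>q = (p - a) / h\<close>, the remainder of the difference quotient of \<open>a \<otimes> a\<close>
  applied to \<open>f\<close> is \<open>\<langle>q - a', f\<rangle> p + \<langle>a', f\<rangle> (p - a) + \<langle>a, f\<rangle> (q - a')\<close>, and each term has a factor
  that tends to \<open>0\<close> independently of \<open>f\<close>.
\<close>

lemma data_hessian_has_operator_pd:
  fixes a :: "'m::finite \<Rightarrow> real^'n::finite \<Rightarrow> 'a::real_inner" and F :: "real^'n \<Rightarrow> 'a \<Rightarrow> real^'m"
  assumes bayes: "\<And>\<eta>. linear_bayes X C v (\<lambda>k. a k \<eta>) (F \<eta>)"
    and a': "\<And>k. a' k \<in> X"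
    and deriv: "\<And>k. ((\<lambda>h. a k (\<xi> + h *\<^sub>R axis j 1)) has_vector_derivative a' k) (at 0)"
  shows "has_operator_pd X j (\<lambda>\<eta>. data_hessian X v (F \<eta>))
    (\<lambda>f. inverse v *\<^sub>R (\<Sum>k\<in>UNIV. tensor (a k \<xi>) (a' k) f + tensor (a' k) (a k \<xi>) f)) \<xi>"
    (is "has_operator_pd X j _ ?D \<xi>")
proof -
  interpret linear_bayes X C v "\<lambda>k. a k \<eta>" "F \<eta>" for \<eta> by (rule bayes)
  define p where "p k h = a k (\<xi> + h *\<^sub>R axis j 1)" for k h
  define q where "q k h = (p k h - a k \<xi>) /\<^sub>R h" for k h
  have p: "(p k \<longlongrightarrow> a k \<xi>) (at 0)" for k
    using has_vector_derivative_continuous[OF deriv[of k]] by (simp add: p_def[abs_def] isCont_def)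
  have q: "(q k \<longlongrightarrow> a' k) (at 0)" for k
    using deriv[of k] unfolding has_vector_derivative_at_0_iff by (simp add: q_def[abs_def] p_def[abs_def])
  define e where "e k h = norm (q k h - a' k) * norm (p k h) + norm (a' k) * norm (p k h - a k \<xi>)
      + norm (a k \<xi>) * norm (q k h - a' k)" for k h
  have e: "(e k \<longlongrightarrow> 0) (at 0)" for k
  proof -
    have "(e k \<longlongrightarrow> norm (a' k - a' k) * norm (a k \<xi>) + norm (a' k) * norm (a k \<xi> - a k \<xi>)
        + norm (a k \<xi>) * norm (a' k - a' k)) (at 0)"
      unfolding e_def[abs_def] by (intro tendsto_intros p q)
    then show ?thesis by simp
  qed
  define T where "T k h f = (tensor (p k h) (p k h) f - tensor (a k \<xi>) (a k \<xi>) f) /\<^sub>R h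
      - (tensor (a k \<xi>) (a' k) f + tensor (a' k) (a k \<xi>) f)" for k h f
  have T: "norm (T k h f) \<le> e k h * norm f" if "h \<noteq> 0" for k h f
  proof -
    have p_eq: "p k h = a k \<xi> + h *\<^sub>R q k h" using that by (simp add: q_def)
    have cancel: "h * (inverse h * y) = y" for y using that by simp
    have "T k h f = inner (q k h - a' k) f *\<^sub>R p k h + inner (a' k) f *\<^sub>R (p k h - a k \<xi>)
        + inner (a k \<xi>) f *\<^sub>R (q k h - a' k)"
      by (simp add: p_eq cancel T_def tensor_def inner_add_left inner_diff_left algebra_simps)
    also have "norm \<dots> \<le> \<bar>inner (q k h - a' k) f\<bar> * norm (p k h)
        + \<bar>inner (a' k) f\<bar> * norm (p k h - a k \<xi>) + \<bar>inner (a k \<xi>) f\<bar> * norm (q k h - a' k)"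
      by (intro norm_triangle_le add_mono) auto
    also have "\<dots> \<le> (norm (q k h - a' k) * norm f) * norm (p k h)
        + (norm (a' k) * norm f) * norm (p k h - a k \<xi>) + (norm (a k \<xi>) * norm f) * norm (q k h - a' k)"
      by (intro add_mono mult_right_mono Cauchy_Schwarz_ineq2) auto
    also have "\<dots> = e k h * norm f" by (simp add: e_def algebra_simps)
    finally show ?thesis .
  qed
  show ?thesis
  proof (rule has_operator_pdI[OF X bounded_operator_data_hessian])
    show "bounded_operator X X ?D"
      by (intro bounded_operator_scaleR bounded_operator_sum bounded_operator_add
          bounded_operator_tensor X a a')
    show "((\<lambda>h. \<bar>inverse v\<bar> * (\<Sum>k\<in>UNIV. e k h)) \<longlongrightarrow> 0) (at 0)"
      by (intro tendsto_mult_right_zero tendsto_null_sum e)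
    show "\<forall>\<^sub>F h in at 0. \<forall>f\<in>X.
       norm ((data_hessian X v (F (\<xi> + h *\<^sub>R axis j 1)) f - data_hessian X v (F \<xi>) f) /\<^sub>R h - ?D f)
       \<le> (\<bar>inverse v\<bar> * (\<Sum>k\<in>UNIV. e k h)) * norm f"
      unfolding eventually_at_filter
    proof (intro always_eventually allI impI ballI)
      fix h :: real and f assume h: "h \<noteq> 0" and f: "f \<in> X"
      have "(data_hessian X v (F (\<xi> + h *\<^sub>R axis j 1)) f - data_hessian X v (F \<xi>) f) /\<^sub>R h - ?D f
          = inverse v *\<^sub>R (\<Sum>k\<in>UNIV. T k h f)"
        using f by (simp add: data_hessian_eq T_def p_def sum_subtractf scaleR_diff_right
            scaleR_sum_right[symmetric] mult.commute[of "inverse h"])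
      also have "norm \<dots> = \<bar>inverse v\<bar> * norm (\<Sum>k\<in>UNIV. T k h f)" by simp
      also have "\<dots> \<le> \<bar>inverse v\<bar> * (\<Sum>k\<in>UNIV. e k h * norm f)"
        using T[OF h] by (intro mult_left_mono sum_norm_le) auto
      finally show "norm ((data_hessian X v (F (\<xi> + h *\<^sub>R axis j 1)) f - data_hessian X v (F \<xi>) f) /\<^sub>R h - ?D f)
          \<le> (\<bar>inverse v\<bar> * (\<Sum>k\<in>UNIV. e k h)) * norm f"
        by (simp add: sum_distrib_right mult.assoc)
    qed
  qed
qed

text \<open>
  Dividing the resolvent identity by \<open>h\<close> gives the product formula with the difference quotient of
  the data Hessian in place of \<open>D\<close> and \<open>P (\<xi> + h)\<close> in place of the last \<open>P \<xi>\<close>; the uniform bound on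
  the posterior covariances makes both replacements harmless.
\<close>

lemma posterior_covariance_has_operator_pd:
  fixes a :: "'m::finite \<Rightarrow> real^'n::finite \<Rightarrow> 'a::real_inner" and F :: "real^'n \<Rightarrow> 'a \<Rightarrow> real^'m"
  assumes bayes: "\<And>\<eta>. linear_bayes X C v (\<lambda>k. a k \<eta>) (F \<eta>)"
    and pd: "has_operator_pd X j (\<lambda>\<eta>. data_hessian X v (F \<eta>)) D \<xi>"
  shows "has_operator_pd X j (\<lambda>\<eta>. posterior_covariance X v C (F \<eta>))
    (\<lambda>f. - posterior_covariance X v C (F \<xi>) (D (posterior_covariance X v C (F \<xi>) f))) \<xi>"
proof -
  interpret linear_bayes X C v "\<lambda>k. a k \<eta>" "F \<eta>" for \<eta> by (rule bayes)
  define P where "P \<eta> = posterior_covariance X v C (F \<eta>)" for \<eta>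
  define A where "A \<eta> = data_hessian X v (F \<eta>)" for \<eta>
  have P: "bounded_operator X X (P \<eta>)" and A: "bounded_operator X X (A \<eta>)" for \<eta>
    unfolding P_def A_def
    by (rule bounded_operator_posterior_covariance, rule bounded_operator_data_hessian)
  have D: "bounded_operator X X D" using pd by (simp add: has_operator_pd_def)
  obtain K where K: "K > 0" "\<And>f. f \<in> X \<Longrightarrow> norm (C f) \<le> K * norm f"
    using bounded_operator_bound[OF C(1)] by blast
  have PK: "norm (P \<eta> f) \<le> K * norm f" if "f \<in> X" for \<eta> f
    unfolding P_def by (rule posterior_covariance_bound[OF K that])
  obtain L where L: "L > 0" "\<And>f. f \<in> X \<Longrightarrow> norm (D f) \<le> L * norm f"
    using bounded_operator_bound[OF D] by blast
  obtain \<epsilon> where \<epsilon>: "(\<epsilon> \<longlongrightarrow> 0) (at 0)" and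
    le: "\<And>h f. f \<in> X \<Longrightarrow> norm ((A (\<xi> + h *\<^sub>R axis j 1) f - A \<xi> f) /\<^sub>R h - D f) \<le> \<epsilon> h * norm f"
    using has_operator_pdD[OF pd X] unfolding A_def by blast
  \<comment> \<open>The first summand bounds \<open>P \<xi> (q - D z)\<close> and the second \<open>P \<xi> (D (z - P \<xi> f))\<close> below.\<close>
  define B where "B h = K * \<bar>\<epsilon> h\<bar> * K + K * L * (\<bar>h\<bar> * (K * (L + \<bar>\<epsilon> h\<bar>) * K))" for h
  have "has_operator_pd X j P (\<lambda>f. - P \<xi> (D (P \<xi> f))) \<xi>"
  proof (rule has_operator_pdI[OF X P])
    show "bounded_operator X X (\<lambda>f. - P \<xi> (D (P \<xi> f)))"
      using bounded_operator_scaleR[OF bounded_operator_compose[OF bounded_operator_compose[OF P D] P] X, of "-1"]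
      by simp
    have "(B \<longlongrightarrow> K * \<bar>0\<bar> * K + K * L * (\<bar>0\<bar> * (K * (L + \<bar>0\<bar>) * K))) (at 0)"
      unfolding B_def[abs_def] by (intro tendsto_intros \<epsilon>)
    then show "(B \<longlongrightarrow> 0) (at 0)" by simp
    show "\<forall>\<^sub>F h in at 0. \<forall>f\<in>X.
       norm ((P (\<xi> + h *\<^sub>R axis j 1) f - P \<xi> f) /\<^sub>R h - - P \<xi> (D (P \<xi> f))) \<le> B h * norm f"
      unfolding eventually_at_filter
    proof (intro always_eventually allI impI ballI)
      fix h :: real and f assume h: "h \<noteq> 0" and f: "f \<in> X"
      let ?\<eta> = "\<xi> + h *\<^sub>R axis j 1"
      define z where "z = P ?\<eta> f"
      define q where "q = (A ?\<eta> z - A \<xi> z) /\<^sub>R h"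
      note mem = bounded_operatorD(1)[OF P] bounded_operatorD(1)[OF A] bounded_operatorD(1)[OF D]
      have z: "z \<in> X" using f mem by (simp add: z_def)
      have q: "q \<in> X" unfolding q_def using z mem X by (intro subspace_scale subspace_diff) auto
      have y: "P \<xi> f \<in> X" using f mem by simp
      have zn: "norm z \<le> K * norm f" unfolding z_def by (rule PK[OF f])
      have hq: "A ?\<eta> z - A \<xi> z = h *\<^sub>R q" using h by (simp add: q_def)
      have "z - P \<xi> f = - P \<xi> (A ?\<eta> z - A \<xi> z)"
        unfolding z_def P_def A_def by (rule posterior_covariance_resolvent[OF bayes bayes f])
      also have "\<dots> = - h *\<^sub>R P \<xi> q"
        unfolding hq using bounded_operatorD(3)[OF P q] by simp
      finally have zf: "z - P \<xi> f = - h *\<^sub>R P \<xi> q" .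
      have "norm (q - D z) \<le> \<epsilon> h * norm z" unfolding q_def by (rule le[OF z])
      also have "\<dots> \<le> \<bar>\<epsilon> h\<bar> * norm z" by (rule mult_right_mono) auto
      finally have qD: "norm (q - D z) \<le> \<bar>\<epsilon> h\<bar> * norm z" .
      have "norm q \<le> norm (D z) + norm (q - D z)" using norm_triangle_ineq[of "D z" "q - D z"] by simp
      also have "\<dots> \<le> L * norm z + \<bar>\<epsilon> h\<bar> * norm z" using L(2)[OF z] qD by (rule add_mono)
      also have "\<dots> = (L + \<bar>\<epsilon> h\<bar>) * norm z" by (simp add: distrib_right)
      also have "\<dots> \<le> (L + \<bar>\<epsilon> h\<bar>) * (K * norm f)" using zn L by (intro mult_left_mono) auto
      finally have qn: "norm q \<le> (L + \<bar>\<epsilon> h\<bar>) * (K * norm f)" .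
      have "norm (z - P \<xi> f) = \<bar>h\<bar> * norm (P \<xi> q)" by (simp add: zf)
      also have "\<dots> \<le> \<bar>h\<bar> * (K * ((L + \<bar>\<epsilon> h\<bar>) * (K * norm f)))"
        using order_trans[OF PK[OF q] mult_left_mono[OF qn]] K by (intro mult_left_mono) auto
      finally have zfn: "norm (z - P \<xi> f) \<le> \<bar>h\<bar> * (K * ((L + \<bar>\<epsilon> h\<bar>) * (K * norm f)))" .
      have "(z - P \<xi> f) /\<^sub>R h - - P \<xi> (D (P \<xi> f)) = - P \<xi> q + P \<xi> (D (P \<xi> f))"
        using h by (simp add: zf)
      also have "\<dots> = - P \<xi> (q - D z) - P \<xi> (D (z - P \<xi> f))"
        using X q z y mem by (simp add: bounded_operator_diff[OF P] bounded_operator_diff[OF D])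
      finally have "norm ((z - P \<xi> f) /\<^sub>R h - - P \<xi> (D (P \<xi> f)))
          \<le> norm (P \<xi> (q - D z)) + norm (P \<xi> (D (z - P \<xi> f)))"
        using norm_triangle_ineq4[of "- P \<xi> (q - D z)" "P \<xi> (D (z - P \<xi> f))"] by simp
      also have "norm (P \<xi> (q - D z)) \<le> K * (\<bar>\<epsilon> h\<bar> * (K * norm f))"
      proof -
        have "norm (P \<xi> (q - D z)) \<le> K * norm (q - D z)"
          using X q z mem by (intro PK subspace_diff) auto
        also have "norm (q - D z) \<le> \<bar>\<epsilon> h\<bar> * (K * norm f)"
          using qD mult_left_mono[OF zn, of "\<bar>\<epsilon> h\<bar>"] by simp
        finally show ?thesis using K by simp
      qed
      also have "norm (P \<xi> (D (z - P \<xi> f))) \<le> K * (L * (\<bar>h\<bar> * (K * ((L + \<bar>\<epsilon> h\<bar>) * (K * norm f)))))"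
      proof -
        have zy: "z - P \<xi> f \<in> X" using X z y by (rule subspace_diff)
        have "norm (P \<xi> (D (z - P \<xi> f))) \<le> K * norm (D (z - P \<xi> f))"
          using zy mem by (intro PK) auto
        also have "norm (D (z - P \<xi> f)) \<le> L * norm (z - P \<xi> f)" by (rule L(2)[OF zy])
        also have "norm (z - P \<xi> f) \<le> \<bar>h\<bar> * (K * ((L + \<bar>\<epsilon> h\<bar>) * (K * norm f)))" by (rule zfn)
        finally show ?thesis using K L by simp
      qed
      also have "K * (\<bar>\<epsilon> h\<bar> * (K * norm f)) + K * (L * (\<bar>h\<bar> * (K * ((L + \<bar>\<epsilon> h\<bar>) * (K * norm f)))))
          = B h * norm f"
        by (simp add: B_def algebra_simps)
      finally show "norm ((P ?\<eta> f - P \<xi> f) /\<^sub>R h - - P \<xi> (D (P \<xi> f))) \<le> B h * norm f"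
        by (simp add: z_def)
    qed
  qed
  then show ?thesis by (simp add: P_def[abs_def])
qed


section \<open>Completeness of the space of square-integrable functions on a bounded set\<close>

lemma L2_rel_refl: "square_integrable f \<Longrightarrow> L2_rel f f"
  by (simp add: L2_rel_def)

lemma square_integrable_rep_L2: "square_integrable (rep_L2 f)"
  using Quotient_rep_reflp[OF Quotient_L2, of f] by (simp add: L2_rel_def)

lemma abs_rep_L2: "abs_L2 (rep_L2 f) = f"
  by (rule Quotient_abs_rep[OF Quotient_L2])

lemma rep_abs_L2: "square_integrable f \<Longrightarrow> AE x in lebesgue. rep_L2 (abs_L2 f) x = f x"
  using Quotient_rep_abs[OF Quotient_L2 L2_rel_refl] by (auto simp: L2_rel_def)

lemma abs_L2_eqI:
  assumes "square_integrable f" "square_integrable g" "AE x in lebesgue. f x = g x"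
  shows "abs_L2 f = abs_L2 g"
  using Quotient_rel_abs[OF Quotient_L2] assms by (auto simp: L2_rel_def)

lemma inner_abs_L2:
  "square_integrable f \<Longrightarrow> square_integrable g \<Longrightarrow>
    inner (abs_L2 f) (abs_L2 g) = (\<integral>x. f x * g x \<partial>lebesgue)"
  by (simp add: inner_L2.abs_eq L2_rel_refl)

lemma norm_abs_L2: "square_integrable f \<Longrightarrow> (norm (abs_L2 f))\<^sup>2 = (\<integral>x. (f x)\<^sup>2 \<partial>lebesgue)"
  by (simp only: power2_norm_eq_inner inner_abs_L2) (simp add: power2_eq_square)

lemma diff_abs_L2:
  "square_integrable f \<Longrightarrow> square_integrable g \<Longrightarrow> abs_L2 f - abs_L2 g = abs_L2 (\<lambda>x. f x - g x)"
  by (simp add: minus_L2.abs_eq L2_rel_refl)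

lemma abs_L2_in_L2_on:
  "square_integrable f \<Longrightarrow> abs_L2 f \<in> L2_on A \<longleftrightarrow> (AE x in lebesgue. x \<notin> A \<longrightarrow> f x = 0)"
  unfolding L2_on_def mem_Collect_eq using rep_abs_L2[of f] by (intro eventually_cong) auto

lemma subspace_L2_on: "subspace (L2_on A)"
proof (rule subspaceI)
  show "0 \<in> L2_on A"
    using abs_L2_in_L2_on[OF square_integrable_zero] by (simp add: zero_L2_def)
next
  fix f g assume fg: "f \<in> L2_on A" "g \<in> L2_on A"
  have "f + g = abs_L2 (\<lambda>x. rep_L2 f x + rep_L2 g x)"
    using plus_L2.abs_eq[OF L2_rel_refl L2_rel_refl, OF square_integrable_rep_L2 square_integrable_rep_L2]
    by (simp add: abs_rep_L2)
  moreover have "AE x in lebesgue. x \<notin> A \<longrightarrow> rep_L2 f x + rep_L2 g x = 0"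
    using fg unfolding L2_on_def by auto
  ultimately show "f + g \<in> L2_on A"
    by (simp add: abs_L2_in_L2_on square_integrable_add square_integrable_rep_L2)
next
  fix c f assume f: "f \<in> L2_on A"
  have "c *\<^sub>R f = abs_L2 (\<lambda>x. c * rep_L2 f x)"
    using scaleR_L2.abs_eq[OF L2_rel_refl, OF square_integrable_rep_L2]
    by (simp add: abs_rep_L2)
  moreover have "AE x in lebesgue. x \<notin> A \<longrightarrow> c * rep_L2 f x = 0"
    using f unfolding L2_on_def by auto
  ultimately show "c *\<^sub>R f \<in> L2_on A"
    by (simp add: abs_L2_in_L2_on square_integrable_scale square_integrable_rep_L2)
qed

lemma square_integrable_bounded:
  assumes "A \<in> lmeasurable" "f \<in> borel_measurable lebesgue"
    and "\<And>x. x \<in> A \<Longrightarrow> \<bar>f x\<bar> \<le> B" "\<And>x. x \<notin> A \<Longrightarrow> f x = 0"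
  shows "square_integrable f"
  unfolding square_integrable_def
proof
  show "integrable lebesgue (\<lambda>x. (f x)\<^sup>2)"
  proof (rule Bochner_Integration.integrable_bound)
    show "integrable lebesgue (\<lambda>x. B\<^sup>2 * indicator A x)"
      using assms(1) by (intro integrable_mult_right integrable_real_indicator)
        (auto simp: fmeasurable_def)
    show "(\<lambda>x. (f x)\<^sup>2) \<in> borel_measurable lebesgue" using assms(2) by simp
    have "norm ((f x)\<^sup>2) \<le> norm (B\<^sup>2 * indicator A x)" for x
      using assms(3)[of x] assms(4)[of x] power_mono[of "\<bar>f x\<bar>" B 2] by (cases "x \<in> A") auto
    then show "AE x in lebesgue. norm ((f x)\<^sup>2) \<le> norm (B\<^sup>2 * indicator A x)" by simp
  qed
qed (rule assms(2))

text \<open>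
  On a bounded set the \<open>L\<^sup>2\<close> norm dominates the \<open>L\<^sup>1\<close> norm, so an \<open>L\<^sup>2\<close>-Cauchy sequence is
  \<open>L\<^sup>1\<close>-Cauchy and a subsequence converges almost everywhere. By Fatou's lemma its pointwise limit
  is also the limit in \<open>L\<^sup>2\<close>.
\<close>

lemma complete_L2_on:
  fixes A :: "'a::euclidean_space set"
  assumes "bounded A"
  shows "complete (L2_on A)"
proof (rule completeI)
  fix s :: "nat \<Rightarrow> 'a L2" assume s: "\<forall>n. s n \<in> L2_on A" and "Cauchy s"
  obtain c where c: "A \<subseteq> cball 0 c"
    using bounded_subset_ballD[OF assms, of 0] ball_subset_cball by blast
  define Q where "Q = cball (0::'a) c"
  have Q: "Q \<in> lmeasurable" unfolding Q_def by simp
  have sqQ: "square_integrable (indicator Q :: 'a \<Rightarrow> real)"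
    by (rule square_integrable_bounded[OF Q, where B = 1])
      (use Q in \<open>auto simp: indicator_def fmeasurable_def\<close>)
  define g where "g n x = rep_L2 (s n) x * indicator Q x" for n x
  have AE_g: "AE x in lebesgue. g n x = rep_L2 (s n) x" for n
  proof -
    have "AE x in lebesgue. x \<notin> A \<longrightarrow> rep_L2 (s n) x = 0"
      using s by (simp add: L2_on_def)
    then show ?thesis
      by eventually_elim (use c in \<open>auto simp: g_def Q_def indicator_def\<close>)
  qed
  have meas: "rep_L2 (s n) \<in> borel_measurable lebesgue" for n
    using square_integrable_rep_L2[of "s n"] by (simp add: square_integrable_def)
  have meas_g[measurable]: "g n \<in> borel_measurable lebesgue" for n
    unfolding g_def[abs_def] using Q
    by (intro borel_measurable_times meas borel_measurable_indicator) (auto simp: fmeasurable_def)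
  have sq: "square_integrable (g n)" for n
    unfolding square_integrable_def
  proof
    have "integrable lebesgue (\<lambda>x. (rep_L2 (s n) x)\<^sup>2)"
      using square_integrable_rep_L2[of "s n"] by (simp add: square_integrable_def)
    then show "integrable lebesgue (\<lambda>x. (g n x)\<^sup>2)"
      by (rule Bochner_Integration.integrable_bound) (rule borel_measurable_power[OF meas_g], simp add: g_def indicator_def)
  qed (rule meas_g)
  have s_eq: "s n = abs_L2 (g n)" for n
    using abs_L2_eqI[OF sq square_integrable_rep_L2 AE_g] by (simp add: abs_rep_L2)
  have zero_g: "AE x in lebesgue. x \<notin> A \<longrightarrow> g n x = 0" for n
    using s abs_L2_in_L2_on[OF sq] by (simp add: s_eq)
  have sqd: "square_integrable (\<lambda>x. g i x - g j x)" for i j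
    by (rule square_integrable_diff[OF sq sq])
  have norm_s: "(norm (s i - s j))\<^sup>2 = (\<integral>x. (g i x - g j x)\<^sup>2 \<partial>lebesgue)" for i j
    by (simp add: s_eq diff_abs_L2 sq norm_abs_L2 sqd)
  have int_g: "integrable lebesgue (g n)" for n
  proof -
    have "(\<lambda>x. g n x * indicator Q x) = g n" by (auto simp: g_def indicator_def)
    then show ?thesis using square_integrable_prod[OF sq[of n] sqQ] by simp
  qed
  define q where "q = norm (abs_L2 (indicator Q :: 'a \<Rightarrow> real))"
  have L1: "(\<integral>x. norm (g i x - g j x) \<partial>lebesgue) \<le> norm (s i - s j) * q" for i j
  proof -
    have sqa: "square_integrable (\<lambda>x. \<bar>g i x - g j x\<bar>)"
      using sqd[of i j] by (auto simp: square_integrable_def)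
    have "(norm (abs_L2 (\<lambda>x. \<bar>g i x - g j x\<bar>)))\<^sup>2 = (norm (s i - s j))\<^sup>2"
      by (simp add: norm_abs_L2[OF sqa] norm_s)
    then have eq: "norm (abs_L2 (\<lambda>x. \<bar>g i x - g j x\<bar>)) = norm (s i - s j)" by simp
    have onQ: "(\<lambda>x. norm (g i x - g j x)) = (\<lambda>x. \<bar>g i x - g j x\<bar> * indicator Q x)"
      by (auto simp: g_def indicator_def)
    have "(\<integral>x. norm (g i x - g j x) \<partial>lebesgue) =
        inner (abs_L2 (\<lambda>x. \<bar>g i x - g j x\<bar>)) (abs_L2 (indicator Q))"
      unfolding onQ inner_abs_L2[OF sqa sqQ] ..
    also have "\<dots> \<le> norm (s i - s j) * q"
      using norm_cauchy_schwarz[of "abs_L2 (\<lambda>x. \<bar>g i x - g j x\<bar>)" "abs_L2 (indicator Q)"]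
      by (simp add: eq q_def)
    finally show ?thesis .
  qed
  have "q \<ge> 0" by (simp add: q_def)
  have L1_Cauchy: "\<exists>N. \<forall>i\<ge>N. \<forall>j\<ge>N. (\<integral>x. norm (g i x - g j x) \<partial>lebesgue) < e" if "e > 0" for e
  proof -
    have "0 < e / (q + 1)" using that \<open>q \<ge> 0\<close> by simp
    then obtain N where N: "\<And>i j. i \<ge> N \<Longrightarrow> j \<ge> N \<Longrightarrow> norm (s i - s j) < e / (q + 1)"
      using CauchyD[OF \<open>Cauchy s\<close>] by metis
    have "(\<integral>x. norm (g i x - g j x) \<partial>lebesgue) < e" if ij: "i \<ge> N" "j \<ge> N" for i j
    proof -
      have "norm (s i - s j) * q \<le> norm (s i - s j) * (q + 1)" by (intro mult_left_mono) auto
      also have "\<dots> < e" using N[OF ij] \<open>q \<ge> 0\<close> by (simp add: pos_less_divide_eq)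
      finally show ?thesis using L1[of i j] by simp
    qed
    then show ?thesis by blast
  qed
  obtain r where r: "strict_mono r" and r_Cauchy: "AE x in lebesgue. Cauchy (\<lambda>i. g (r i) x)"
    using cauchy_L1_AE_cauchy_subseq[OF int_g L1_Cauchy] by blast
  define u where "u x = lim (\<lambda>i. g (r i) x)" for x
  have u_meas[measurable]: "u \<in> borel_measurable lebesgue"
    unfolding u_def[abs_def] by measurable
  have u_lim: "AE x in lebesgue. (\<lambda>i. g (r i) x) \<longlonglongrightarrow> u x"
    using r_Cauchy by eventually_elim (simp add: u_def Cauchy_convergent_iff convergent_LIMSEQ_iff)
  have Fatou: "(\<integral>\<^sup>+x. ennreal ((u x - g n x)\<^sup>2) \<partial>lebesgue) \<le> ennreal (e\<^sup>2)"
    if N: "\<And>i. i \<ge> N \<Longrightarrow> norm (s i - s n) < e" for N n e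
  proof -
    have "(\<integral>\<^sup>+x. ennreal ((u x - g n x)\<^sup>2) \<partial>lebesgue) =
        (\<integral>\<^sup>+x. liminf (\<lambda>i. ennreal ((g (r i) x - g n x)\<^sup>2)) \<partial>lebesgue)"
    proof (rule nn_integral_cong_AE)
      show "AE x in lebesgue. ennreal ((u x - g n x)\<^sup>2) = liminf (\<lambda>i. ennreal ((g (r i) x - g n x)\<^sup>2))"
        using u_lim
      proof eventually_elim
        case (elim x)
        have "(\<lambda>i. ennreal ((g (r i) x - g n x)\<^sup>2)) \<longlonglongrightarrow> ennreal ((u x - g n x)\<^sup>2)"
          by (intro tendsto_ennrealI tendsto_intros elim)
        then show ?case by (intro lim_imp_Liminf[symmetric]) simp_all
      qed
    qed
    also have "\<dots> \<le> liminf (\<lambda>i. \<integral>\<^sup>+x. ennreal ((g (r i) x - g n x)\<^sup>2) \<partial>lebesgue)"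
      by (rule nn_integral_liminf) measurable
    also have "\<dots> \<le> ennreal (e\<^sup>2)"
    proof (rule Liminf_le)
      have "(\<integral>\<^sup>+x. ennreal ((g (r i) x - g n x)\<^sup>2) \<partial>lebesgue) \<le> ennreal (e\<^sup>2)" if "i \<ge> N" for i
      proof -
        have "r i \<ge> N" using seq_suble[OF r, of i] that by simp
        have "(\<integral>\<^sup>+x. ennreal ((g (r i) x - g n x)\<^sup>2) \<partial>lebesgue) = ennreal ((norm (s (r i) - s n))\<^sup>2)"
          unfolding norm_s using sqd by (intro nn_integral_eq_integral) (auto simp: square_integrable_def)
        also have "\<dots> \<le> ennreal (e\<^sup>2)"
          using N[OF \<open>r i \<ge> N\<close>] by (intro ennreal_leI power_mono) auto
        finally show ?thesis .
      qed
      then show "\<forall>\<^sub>F i in sequentially. (\<integral>\<^sup>+x. ennreal ((g (r i) x - g n x)\<^sup>2) \<partial>lebesgue) \<le> ennreal (e\<^sup>2)"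
        by (auto simp: eventually_sequentially)
    qed simp
    finally show ?thesis .
  qed
  have sq_ug: "square_integrable (\<lambda>x. u x - g n x)"
    if N: "\<And>i. i \<ge> N \<Longrightarrow> norm (s i - s n) < e" for N n e
    unfolding square_integrable_def
  proof
    show "integrable lebesgue (\<lambda>x. (u x - g n x)\<^sup>2)"
      using le_less_trans[OF Fatou[of N n e, OF N] ennreal_less_top]
      by (intro integrableI_nonneg) auto
  qed measurable
  obtain N1 where N1: "\<And>i. i \<ge> N1 \<Longrightarrow> norm (s i - s N1) < 1"
    using CauchyD[OF \<open>Cauchy s\<close>, of 1] by auto
  have "square_integrable (\<lambda>x. (u x - g N1 x) + g N1 x)"
    by (rule square_integrable_add[OF sq_ug sq]) (rule N1)
  then have sq_u: "square_integrable u" by simp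
  have "AE x in lebesgue. \<forall>n. x \<notin> A \<longrightarrow> g n x = 0"
    unfolding AE_all_countable using zero_g by blast
  then have "AE x in lebesgue. x \<notin> A \<longrightarrow> u x = 0"
    by eventually_elim (auto simp: u_def)
  then have "abs_L2 u \<in> L2_on A" by (simp add: abs_L2_in_L2_on[OF sq_u])
  moreover have "s \<longlonglongrightarrow> abs_L2 u"
  proof (rule LIMSEQ_I)
    fix e :: real assume "e > 0"
    then have e2: "e / 2 > 0" by simp
    obtain N where N: "\<And>i n. i \<ge> N \<Longrightarrow> n \<ge> N \<Longrightarrow> norm (s i - s n) < e / 2"
      using CauchyD[OF \<open>Cauchy s\<close> e2] by blast
    have "norm (s n - abs_L2 u) < e" if n: "n \<ge> N" for n
    proof -
      have near: "norm (s i - s n) < e / 2" if "i \<ge> N" for i by (rule N[OF that n])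
      have sqn: "square_integrable (\<lambda>x. u x - g n x)" using near by (rule sq_ug)
      have "ennreal ((norm (abs_L2 u - s n))\<^sup>2) = (\<integral>\<^sup>+x. ennreal ((u x - g n x)\<^sup>2) \<partial>lebesgue)"
        unfolding s_eq diff_abs_L2[OF sq_u sq] norm_abs_L2[OF sqn]
        using sqn by (intro nn_integral_eq_integral[symmetric]) (auto simp: square_integrable_def)
      also have "\<dots> \<le> ennreal ((e / 2)\<^sup>2)" using near by (rule Fatou)
      finally have "(norm (abs_L2 u - s n))\<^sup>2 \<le> (e / 2)\<^sup>2"
        by (simp add: ennreal_le_iff)
      then have "norm (abs_L2 u - s n) \<le> e / 2" by (rule power2_le_imp_le) (use e2 in simp)
      then show ?thesis using \<open>e > 0\<close> by (simp add: norm_minus_commute)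
    qed
    then show "\<exists>N. \<forall>n\<ge>N. norm (s n - abs_L2 u) < e" by blast
  qed
  ultimately show "\<exists>l\<in>L2_on A. s \<longlonglongrightarrow> l" by blast
qed


section \<open>Differentiating the path kernel\<close>

text \<open>
  Dominated convergence for the difference quotients. The local Lipschitz bound and the bound on
  \<open>f\<close> combine into a Lipschitz bound valid for all \<open>h\<close>.
\<close>

lemma L2_of_has_vector_derivative:
  fixes f :: "real \<Rightarrow> 'a::euclidean_space \<Rightarrow> real"
  assumes A: "A \<in> lmeasurable"
    and meas: "\<And>h. (\<lambda>x. if x \<in> A then f h x else 0) \<in> borel_measurable lebesgue"
    and bound: "\<And>h x. x \<in> A \<Longrightarrow> \<bar>f h x\<bar> \<le> B"
    and lip: "\<And>h x. x \<in> A \<Longrightarrow> \<bar>h\<bar> \<le> 1 \<Longrightarrow> \<bar>f h x - f 0 x\<bar> \<le> K * \<bar>h\<bar>"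
    and deriv: "\<And>x. x \<in> A \<Longrightarrow> ((\<lambda>h. f h x) has_real_derivative f' x) (at 0)"
  shows "((\<lambda>h. L2_of A (f h)) has_vector_derivative L2_of A f') (at 0)"
proof -
  define ext where "ext u x = (if x \<in> A then u x else 0)" for u :: "'a \<Rightarrow> real" and x
  define q where "q h x = (f h x - f 0 x) / h" for h x
  define M where "M = max K (2 * B)"
  have q_le: "\<bar>q h x\<bar> \<le> M" if x: "x \<in> A" and "h \<noteq> 0" for h x
  proof -
    have "0 \<le> B" using bound[OF x, of 0] by simp
    have "\<bar>f h x - f 0 x\<bar> \<le> M * \<bar>h\<bar>"
    proof (cases "\<bar>h\<bar> \<le> 1")
      case True
      then show ?thesis
        using lip[OF x True] mult_right_mono[of K M "\<bar>h\<bar>"] by (simp add: M_def)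
    next
      case False
      have "\<bar>f h x - f 0 x\<bar> \<le> 2 * B * 1"
        using bound[OF x, of h] bound[OF x, of 0] by linarith
      also have "\<dots> \<le> M * \<bar>h\<bar>"
        using False \<open>0 \<le> B\<close> by (intro mult_mono) (auto simp: M_def)
      finally show ?thesis .
    qed
    then show ?thesis using \<open>h \<noteq> 0\<close> by (simp add: q_def abs_divide divide_le_eq)
  qed
  have q_lim: "((\<lambda>h. q h x) \<longlongrightarrow> f' x) (at 0)" if "x \<in> A" for x
    using deriv[OF that] by (simp add: has_field_derivative_iff q_def)
  have q_seq: "(\<lambda>n. q (X n) x) \<longlonglongrightarrow> f' x" if "x \<in> A" "\<And>n. X n \<noteq> 0" "X \<longlonglongrightarrow> 0" for x X
    using q_lim[OF that(1)] that(2,3) by (auto simp: tendsto_at_iff_sequentially o_def)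
  have meas_f: "ext (f h) \<in> borel_measurable lebesgue" for h
    using meas[of h] by (simp add: ext_def[abs_def])
  have meas_q[measurable]: "ext (q h) \<in> borel_measurable lebesgue" for h
  proof -
    have "ext (q h) = (\<lambda>x. (ext (f h) x - ext (f 0) x) / h)" by (auto simp: ext_def q_def)
    with meas_f show ?thesis by simp
  qed
  have seq0: "(\<lambda>n. inverse (real (Suc n))) \<longlonglongrightarrow> 0" by (rule LIMSEQ_inverse_real_of_nat)
  have f'_le: "\<bar>f' x\<bar> \<le> M" if x: "x \<in> A" for x
    by (rule LIMSEQ_le_const2[OF tendsto_rabs[OF q_seq[OF x _ seq0]]]) (use q_le[OF x] in auto)
  have meas_f'[measurable]: "ext f' \<in> borel_measurable lebesgue"
  proof (rule borel_measurable_LIMSEQ_real)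
    show "(\<lambda>n. ext (q (inverse (real (Suc n)))) x) \<longlonglongrightarrow> ext f' x" for x
      using q_seq[OF _ _ seq0, of x] by (cases "x \<in> A") (auto simp: ext_def)
  qed (rule meas_q)
  have sq_f: "square_integrable (ext (f h))" for h
    by (rule square_integrable_bounded[OF A meas_f, where B = B]) (auto simp: ext_def bound)
  have sq_f': "square_integrable (ext f')"
    by (rule square_integrable_bounded[OF A meas_f', where B = M]) (auto simp: ext_def f'_le)
  have L2_of: "L2_of A u = abs_L2 (ext u)" for u by (simp add: L2_of_def ext_def[abs_def])
  have quot: "(L2_of A (f h) - L2_of A (f 0)) /\<^sub>R h - L2_of A f' = abs_L2 (\<lambda>x. ext (q h) x - ext f' x)" for h
  proof -
    have "(L2_of A (f h) - L2_of A (f 0)) /\<^sub>R h = abs_L2 (\<lambda>x. inverse h * (ext (f h) x - ext (f 0) x))"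
      by (simp add: L2_of diff_abs_L2 sq_f scaleR_L2.abs_eq L2_rel_refl square_integrable_diff)
    also have "(\<lambda>x. inverse h * (ext (f h) x - ext (f 0) x)) = ext (q h)"
      by (auto simp: ext_def q_def divide_inverse)
    finally have eq: "(L2_of A (f h) - L2_of A (f 0)) /\<^sub>R h = abs_L2 (ext (q h))" .
    have "square_integrable (\<lambda>x. inverse h * (ext (f h) x - ext (f 0) x))"
      by (intro square_integrable_scale square_integrable_diff sq_f)
    also have "(\<lambda>x. inverse h * (ext (f h) x - ext (f 0) x)) = ext (q h)"
      by (auto simp: ext_def q_def divide_inverse)
    finally show ?thesis unfolding eq unfolding L2_of by (rule diff_abs_L2[OF _ sq_f'])
  qed
  have sq_qf': "square_integrable (\<lambda>x. ext (q h) x - ext f' x)" if "h \<noteq> 0" for h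
  proof (rule square_integrable_diff[OF _ sq_f'])
    show "square_integrable (ext (q h))"
      by (rule square_integrable_bounded[OF A meas_q, where B = M]) (auto simp: ext_def q_le that)
  qed
  show ?thesis
    unfolding has_vector_derivative_at_0_iff tendsto_at_iff_sequentially
  proof (intro allI impI)
    fix X :: "nat \<Rightarrow> real" assume "\<forall>i. X i \<in> UNIV - {0}" and X0: "X \<longlonglongrightarrow> 0"
    then have X: "X n \<noteq> 0" for n by auto
    have "(\<lambda>n. \<integral>x. (ext (q (X n)) x - ext f' x)\<^sup>2 \<partial>lebesgue) \<longlonglongrightarrow> (\<integral>x. (0::real) \<partial>(lebesgue :: 'a measure))"
    proof (rule integral_dominated_convergence)
      show "integrable lebesgue (\<lambda>x. (2 * M)\<^sup>2 * indicator A x)"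
        using A by (intro integrable_mult_right integrable_real_indicator) (auto simp: fmeasurable_def)
      have "(\<lambda>n. (ext (q (X n)) x - ext f' x)\<^sup>2) \<longlonglongrightarrow> 0" for x
      proof (cases "x \<in> A")
        case True
        have "(\<lambda>n. (q (X n) x - f' x)\<^sup>2) \<longlonglongrightarrow> (f' x - f' x)\<^sup>2"
          by (intro tendsto_intros q_seq True X X0)
        then show ?thesis using True by (simp add: ext_def)
      qed (simp add: ext_def)
      then show "AE x in lebesgue. (\<lambda>n. (ext (q (X n)) x - ext f' x)\<^sup>2) \<longlonglongrightarrow> 0" by simp
      have "norm ((ext (q (X n)) x - ext f' x)\<^sup>2) \<le> (2 * M)\<^sup>2 * indicator A x" for n x
      proof (cases "x \<in> A")
        case True
        then have "\<bar>q (X n) x - f' x\<bar> \<le> 2 * M" using q_le[OF True X[of n]] f'_le[OF True] by (smt (verit))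
        then have "\<bar>q (X n) x - f' x\<bar>\<^sup>2 \<le> (2 * M)\<^sup>2" by (intro power_mono) auto
        then show ?thesis using True by (simp add: ext_def)
      qed (simp add: ext_def)
      then show "AE x in lebesgue. norm ((ext (q (X n)) x - ext f' x)\<^sup>2) \<le> (2 * M)\<^sup>2 * indicator A x" for n
        by simp
    qed measurable
    then have "(\<lambda>n. (norm (abs_L2 (\<lambda>x. ext (q (X n)) x - ext f' x)))\<^sup>2) \<longlonglongrightarrow> 0"
      by (simp add: norm_abs_L2 sq_qf' X)
    from tendsto_real_sqrt[OF this]
    have "(\<lambda>n. norm (abs_L2 (\<lambda>x. ext (q (X n)) x - ext f' x))) \<longlonglongrightarrow> 0" by simp
    from tendsto_norm_zero_cancel[OF this]
    have "(\<lambda>n. (L2_of A (f (X n)) - L2_of A (f 0)) /\<^sub>R X n - L2_of A f') \<longlonglongrightarrow> 0"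
      by (simp add: quot)
    from LIM_zero_cancel[OF this]
    show "((\<lambda>h. (L2_of A (f h) - L2_of A (f 0)) /\<^sub>R h) \<circ> X) \<longlonglongrightarrow> L2_of A f'"
      by (simp add: o_def)
  qed
qed

text \<open>
  The projection is Borel, and the preimage \<open>UNIV \<times> N\<close> of a null set is null because \<open>\<infinity> \<cdot> 0 = 0\<close>.
  This is needed for paths that are only Lebesgue measurable in time.
\<close>

lemma measurable_snd_lebesgue:
  "snd \<in> measurable (lebesgue :: ('a::euclidean_space \<times> 'b::euclidean_space) measure) lebesgue"
proof (rule completion.measurable_completion2)
  show m: "snd \<in> measurable (lebesgue :: ('a \<times> 'b) measure) lborel"
    by (intro measurable_completion) (simp add: borel_measurable_continuous_onI continuous_on_snd)
  show "null_sets lborel \<subseteq> null_sets (distr lebesgue lborel (snd :: 'a \<times> 'b \<Rightarrow> 'b))"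
  proof
    fix N :: "'b set" assume N: "N \<in> null_sets lborel"
    have "emeasure lborel ((UNIV :: 'a set) \<times> N) = emeasure lborel (UNIV :: 'a set) * emeasure lborel N"
      unfolding lborel_prod[symmetric] using N by (intro lborel.emeasure_pair_measure_Times) auto
    moreover have "(UNIV :: 'a set) \<times> N \<in> sets lborel"
      unfolding lborel_prod[symmetric] using N by (intro pair_measureI) auto
    ultimately have "(UNIV :: 'a set) \<times> N \<in> null_sets lborel"
      using N by (intro null_setsI) (auto simp: null_sets_def)
    then have "(UNIV :: 'a set) \<times> N \<in> null_sets lebesgue"
      by (rule null_sets_completionI)
    moreover have "snd -` N \<inter> space (lebesgue :: ('a \<times> 'b) measure) = UNIV \<times> N" by auto
    ultimately show "N \<in> null_sets (distr lebesgue lborel (snd :: 'a \<times> 'b \<Rightarrow> 'b))"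
      using N by (simp add: null_sets_distr_iff[OF m] null_setsD2[of N lborel, simplified])
  qed
qed

lemma has_pd_imp_segment_derivative:
  assumes "has_pd j p (\<xi> + s *\<^sub>R axis j 1)"
  shows "((\<lambda>h. p (\<xi> + h *\<^sub>R axis j 1)) has_vector_derivative pd j p (\<xi> + s *\<^sub>R axis j 1)) (at s)"
proof -
  let ?p = "\<lambda>h. p (\<xi> + s *\<^sub>R axis j 1 + h *\<^sub>R axis j 1)"
  have "(?p has_vector_derivative pd j p (\<xi> + s *\<^sub>R axis j 1)) (at 0)"
    using assms unfolding has_pd_def pd_def by (simp add: vector_derivative_works)
  moreover have "((\<lambda>h. h - s) has_vector_derivative 1) (at s)"
    by (auto intro!: derivative_eq_intros)
  ultimately have "(?p \<circ> (\<lambda>h. h - s) has_vector_derivative 1 *\<^sub>R pd j p (\<xi> + s *\<^sub>R axis j 1)) (at s)"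
    by (intro vector_diff_chain_at) auto
  moreover have "?p \<circ> (\<lambda>h. h - s) = (\<lambda>h. p (\<xi> + h *\<^sub>R axis j 1))"
    by (auto simp: scaleR_diff_left)
  ultimately show ?thesis by simp
qed

lemma delta_path_segment_derivative:
  assumes "has_pd j (r t) (\<xi> + s *\<^sub>R axis j 1)" "\<epsilon>x > 0"
  shows "((\<lambda>h. delta_path \<epsilon>x r x t (\<xi> + h *\<^sub>R axis j 1)) has_real_derivative
    delta_path \<epsilon>x r x t (\<xi> + s *\<^sub>R axis j 1) *
      (inner (x - r t (\<xi> + s *\<^sub>R axis j 1)) (pd j (r t) (\<xi> + s *\<^sub>R axis j 1)) / \<epsilon>x)) (at s)"
proof -
  let ?p = "\<lambda>h. r t (\<xi> + h *\<^sub>R axis j 1)" and ?p' = "pd j (r t) (\<xi> + s *\<^sub>R axis j 1)"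
  have "(?p has_vector_derivative ?p') (at s)"
    by (rule has_pd_imp_segment_derivative[OF assms(1)])
  then have d: "((\<lambda>h. x - ?p h) has_vector_derivative - ?p') (at s)"
    by (auto intro!: derivative_eq_intros)
  have "((\<lambda>h. inner (x - ?p h) (x - ?p h)) has_real_derivative - 2 * inner (x - ?p s) ?p') (at s)"
    unfolding has_real_derivative_iff_has_vector_derivative
    by (rule has_vector_derivative_eq_rhs[OF bounded_bilinear.has_vector_derivative[OF bounded_bilinear_inner d d]])
      (simp add: inner_commute)
  then have "((\<lambda>h. (norm (x - ?p h))\<^sup>2) has_real_derivative - 2 * inner (x - ?p s) ?p') (at s)"
    by (simp add: power2_norm_eq_inner)
  note this[THEN DERIV_cmult, of "- inverse (2 * \<epsilon>x)", THEN DERIV_fun_exp, THEN DERIV_cdivide,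
      of "2 * pi * \<epsilon>x"]
  then show ?thesis
    unfolding delta_path_def by (rule DERIV_cong_ev[THEN iffD1, rotated -1]) (use assms(2) in \<open>auto simp: field_simps\<close>)
qed

lemma pd_delta_path:
  assumes "has_pd j (r t) \<xi>" "\<epsilon>x > 0"
  shows "((\<lambda>h. delta_path \<epsilon>x r x t (\<xi> + h *\<^sub>R axis j 1)) has_real_derivative
    pd j (delta_path \<epsilon>x r x t) \<xi>) (at 0)"
  using delta_path_segment_derivative[of j r t \<xi> 0 \<epsilon>x x] assms
  by (simp add: pd_def has_real_derivative_iff_has_vector_derivative vector_derivative_at)

lemma abs_delta_path_le: "\<epsilon>x > 0 \<Longrightarrow> \<bar>delta_path \<epsilon>x r x t \<eta>\<bar> \<le> 1 / (2 * pi * \<epsilon>x)"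
  by (simp add: delta_path_def abs_mult divide_right_mono)


lemma borel_measurable_path_kernel:
  fixes \<Omega> :: "(real^2) set" and r :: "real \<Rightarrow> real^'n::finite \<Rightarrow> real^2"
  assumes \<Omega>: "open \<Omega>" and Ty: "compact Ty"
    and r: "(\<lambda>t. r t \<eta>) \<in> borel_measurable (lebesgue_on Ty)" and w: "continuous_on UNIV w"
  shows "(\<lambda>z. if z \<in> \<Omega> \<times> Ty then w (snd z) * delta_path \<epsilon>x r (fst z) (snd z) \<eta> else 0)
    \<in> borel_measurable lebesgue"
proof -
  define \<rho> where "\<rho> t = (if t \<in> Ty then r t \<eta> else 0)" for t
  have "\<rho> \<in> borel_measurable lebesgue"
    unfolding \<rho>_def[abs_def] using r by (rule borel_measurable_if_I) (use Ty in \<open>simp add: compact_imp_closed\<close>)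
  from measurable_compose[OF measurable_snd_lebesgue this]
  have [measurable]: "(\<lambda>z. \<rho> (snd z)) \<in> borel_measurable (lebesgue :: ((real^2) \<times> real) measure)" .
  have [measurable]: "(\<lambda>z. w (snd z)) \<in> borel_measurable (lebesgue :: ((real^2) \<times> real) measure)"
    by (intro measurable_completion)
      (simp add: borel_measurable_continuous_onI continuous_on_compose2[OF w] continuous_on_snd)
  have [measurable]: "fst \<in> borel_measurable (lebesgue :: ((real^2) \<times> real) measure)"
    by (intro measurable_completion) (simp add: borel_measurable_continuous_onI continuous_on_fst)
  have "\<Omega> \<times> Ty \<in> sets borel"
    using \<Omega> Ty by (intro borel_Times) (auto intro: borel_compact)
  then have [measurable]: "\<Omega> \<times> Ty \<in> sets lebesgue" by simp
  have "(\<lambda>z. if z \<in> \<Omega> \<times> Ty then w (snd z) * delta_path \<epsilon>x r (fst z) (snd z) \<eta> else 0) =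
      (\<lambda>z. indicator (\<Omega> \<times> Ty) z *
        (w (snd z) * (exp (- (norm (fst z - \<rho> (snd z)))\<^sup>2 / (2 * \<epsilon>x)) / (2 * pi * \<epsilon>x))))"
    by (auto simp: delta_path_def \<rho>_def indicator_def)
  also have "\<dots> \<in> borel_measurable lebesgue" by measurable
  finally show ?thesis .
qed

text \<open>
  The weight stands for \<open>1\<close> or for a mollifier in time. The kernel is Lipschitz along the segment by
  the mean value theorem: the exponential is at most \<open>1\<close>, \<open>x - r t \<eta>\<close> is bounded since both points lie
  in \<open>\<Omega>\<close>, and the partial derivative of the path is continuous on the compact product of \<open>Ty\<close> with
  the segment.
\<close>

lemma weighted_path_kernel_has_vector_derivative:
  fixes \<Omega> :: "(real^2) set" and r :: "real \<Rightarrow> real^'n::finite \<Rightarrow> real^2"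
  assumes \<Omega>: "open \<Omega>" "bounded \<Omega>" and Ty: "compact Ty"
    and r_range: "\<And>t \<eta>. t \<in> Ty \<Longrightarrow> r t \<eta> \<in> \<Omega>"
    and r_measurable: "\<And>\<eta>. (\<lambda>t. r t \<eta>) \<in> borel_measurable (lebesgue_on Ty)"
    and r_pd: "\<And>t \<eta>. t \<in> Ty \<Longrightarrow> has_pd j (r t) \<eta>"
    and r_pd_cont: "continuous_on (Ty \<times> UNIV) (\<lambda>(t, \<eta>). pd j (r t) \<eta>)"
    and \<epsilon>x: "\<epsilon>x > 0" and w: "continuous_on UNIV w"
  shows "((\<lambda>h. L2_of (\<Omega> \<times> Ty) (\<lambda>(x, t). w t * delta_path \<epsilon>x r x t (\<xi> + h *\<^sub>R axis j 1)))
    has_vector_derivative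
      L2_of (\<Omega> \<times> Ty) (\<lambda>(x, t). w t * pd j (delta_path \<epsilon>x r x t) \<xi>)) (at 0)"
proof -
  obtain W where W: "W > 0" "\<And>t. t \<in> Ty \<Longrightarrow> \<bar>w t\<bar> \<le> W"
  proof -
    have "bounded (w ` Ty)"
      using Ty w by (intro compact_imp_bounded compact_continuous_image) (auto elim: continuous_on_subset)
    then show ?thesis using that by (auto simp: bounded_pos)
  qed
  obtain R where R: "R > 0" "\<And>x. x \<in> \<Omega> \<Longrightarrow> norm x \<le> R"
    using \<Omega>(2) by (auto simp: bounded_pos)
  let ?seg = "\<lambda>h. \<xi> + h *\<^sub>R axis j 1"
  obtain P where P: "P > 0" "\<And>t h. t \<in> Ty \<Longrightarrow> \<bar>h\<bar> \<le> 1 \<Longrightarrow> norm (pd j (r t) (?seg h)) \<le> P"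
  proof -
    have "compact ((\<lambda>(t, \<eta>). pd j (r t) \<eta>) ` (Ty \<times> ?seg ` {-1..1}))"
      using Ty by (intro compact_continuous_image compact_Times continuous_on_subset[OF r_pd_cont])
        (auto intro!: continuous_intros)
    from compact_imp_bounded[OF this, unfolded bounded_pos]
    obtain P where P: "P > 0" "\<And>y. y \<in> (\<lambda>(t, \<eta>). pd j (r t) \<eta>) ` (Ty \<times> ?seg ` {-1..1}) \<Longrightarrow> norm y \<le> P"
      by blast
    have "norm (pd j (r t) (?seg h)) \<le> P" if "t \<in> Ty" "\<bar>h\<bar> \<le> 1" for t h
    proof -
      have "(t, ?seg h) \<in> Ty \<times> ?seg ` {-1..1}" using that by (intro SigmaI imageI) auto
      from P(2)[OF imageI[OF this]] show ?thesis by simp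
    qed
    with P(1) show ?thesis using that by blast
  qed
  define d where "d = 1 / (2 * pi * \<epsilon>x)"
  have d: "d > 0" unfolding d_def using \<epsilon>x by (intro divide_pos_pos mult_pos_pos) auto
  define K where "K = d * ((2 * R) * P / \<epsilon>x)"
  have Lipschitz: "\<bar>delta_path \<epsilon>x r x t (?seg h) - delta_path \<epsilon>x r x t (?seg 0)\<bar> \<le> K * \<bar>h\<bar>"
    if x: "x \<in> \<Omega>" and t: "t \<in> Ty" and h: "\<bar>h\<bar> \<le> 1" for x t h
  proof -
    let ?D = "\<lambda>s. delta_path \<epsilon>x r x t (?seg s) * (inner (x - r t (?seg s)) (pd j (r t) (?seg s)) / \<epsilon>x)"
    have "norm (delta_path \<epsilon>x r x t (?seg h) - delta_path \<epsilon>x r x t (?seg 0)) \<le> K * norm (h - 0)"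
    proof (rule field_differentiable_bound[where S = "{-1..1}" and f' = ?D])
      show "((\<lambda>s. delta_path \<epsilon>x r x t (?seg s)) has_field_derivative ?D s) (at s within {-1..1})" for s
        by (rule has_field_derivative_at_within, rule delta_path_segment_derivative) (rule r_pd[OF t], rule \<epsilon>x)
      show "norm (?D s) \<le> K" if s: "s \<in> {-1..1}" for s
      proof -
        have "\<bar>inner (x - r t (?seg s)) (pd j (r t) (?seg s))\<bar>
            \<le> norm (x - r t (?seg s)) * norm (pd j (r t) (?seg s))"
          by (rule Cauchy_Schwarz_ineq2)
        also have "\<dots> \<le> (2 * R) * P"
        proof (rule mult_mono)
          show "norm (x - r t (?seg s)) \<le> 2 * R"
            using norm_triangle_ineq4[of x "r t (?seg s)"] R(2)[OF x] R(2)[OF r_range[OF t], of "?seg s"]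
            by linarith
          show "norm (pd j (r t) (?seg s)) \<le> P" using s by (intro P t) auto
        qed (use R in auto)
        finally show ?thesis
          unfolding K_def real_norm_def abs_mult abs_divide
          using abs_delta_path_le[OF \<epsilon>x, of r x t "?seg s"] \<epsilon>x d
          by (intro mult_mono) (auto simp: d_def divide_right_mono)
      qed
    qed (use h in auto)
    then show ?thesis by simp
  qed
  have pd_delta: "((\<lambda>h. delta_path \<epsilon>x r x t (?seg h)) has_real_derivative pd j (delta_path \<epsilon>x r x t) \<xi>) (at 0)"
    if "t \<in> Ty" for x t
    by (rule pd_delta_path) (rule r_pd[OF that], rule \<epsilon>x)
  have meas: "(\<lambda>z. if z \<in> \<Omega> \<times> Ty then (case z of (x, t) \<Rightarrow> w t * delta_path \<epsilon>x r x t \<eta>) else 0)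
      \<in> borel_measurable lebesgue" for \<eta>
    using borel_measurable_path_kernel[where r = r and \<eta> = \<eta> and \<epsilon>x = \<epsilon>x, OF \<Omega>(1) Ty r_measurable w] by (simp only: case_prod_beta)
  show ?thesis
  proof (rule L2_of_has_vector_derivative[where B = "W * d" and K = "W * K"])
    show "\<Omega> \<times> Ty \<in> lmeasurable"
    proof (rule bounded_set_imp_lmeasurable)
      show "bounded (\<Omega> \<times> Ty)" using \<Omega>(2) Ty by (simp add: bounded_Times compact_imp_bounded)
      have "\<Omega> \<times> Ty \<in> sets borel"
        using \<Omega> Ty by (intro borel_Times) (auto intro: borel_compact)
      then show "\<Omega> \<times> Ty \<in> sets lebesgue" by simp
    qed
  next
    fix h and z :: "(real^2) \<times> real" assume z: "z \<in> \<Omega> \<times> Ty"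
    obtain x t where xt: "z = (x, t)" "x \<in> \<Omega>" "t \<in> Ty" using z by auto
    have "\<bar>w t\<bar> * \<bar>delta_path \<epsilon>x r x t (?seg h)\<bar> \<le> W * d"
      using W(1) W(2)[OF xt(3)] abs_delta_path_le[OF \<epsilon>x, of r x t "?seg h"]
      by (intro mult_mono) (auto simp: d_def)
    then show "\<bar>case z of (x, t) \<Rightarrow> w t * delta_path \<epsilon>x r x t (?seg h)\<bar> \<le> W * d"
      by (simp add: xt abs_mult)
    show "((\<lambda>h. case z of (x, t) \<Rightarrow> w t * delta_path \<epsilon>x r x t (?seg h)) has_real_derivative
        (case z of (x, t) \<Rightarrow> w t * pd j (delta_path \<epsilon>x r x t) \<xi>)) (at 0)"
      using DERIV_cmult[OF pd_delta[OF xt(3)]] by (simp add: xt)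
    assume h: "\<bar>h\<bar> \<le> 1"
    have "\<bar>w t\<bar> * \<bar>delta_path \<epsilon>x r x t (?seg h) - delta_path \<epsilon>x r x t (?seg 0)\<bar> \<le> W * (K * \<bar>h\<bar>)"
      using W(1) W(2)[OF xt(3)] Lipschitz[OF xt(2,3) h] by (intro mult_mono) auto
    then show "\<bar>(case z of (x, t) \<Rightarrow> w t * delta_path \<epsilon>x r x t (?seg h)) -
        (case z of (x, t) \<Rightarrow> w t * delta_path \<epsilon>x r x t (?seg 0))\<bar> \<le> W * K * \<bar>h\<bar>"
      by (simp add: xt abs_mult[symmetric] right_diff_distrib mult.assoc)
  qed (rule meas)
qed


section \<open>The derivative of the posterior covariance\<close>

theorem theorem4:
  fixes \<Omega> :: "(real^2) set" and T Ty :: "real set"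
    and r :: "real \<Rightarrow> real^'n::finite \<Rightarrow> real^2" and tm :: "'m::finite \<Rightarrow> real"
    and \<epsilon>x \<epsilon>t a1 a2 \<sigma> :: real
    and S :: "(real^2) L2 \<Rightarrow> ((real^2) \<times> real) L2"
    and D :: "(real^2) L2 set" and E Cpr :: "(real^2) L2 \<Rightarrow> (real^2) L2"
    and \<M> :: "(real^2) L2 set" and \<U> :: "((real^2) \<times> real) L2 set"
    and \<delta> :: "real^'n \<Rightarrow> ((real^2) \<times> real) L2" and d\<delta> :: "'n \<Rightarrow> real^'n \<Rightarrow> ((real^2) \<times> real) L2"
    and \<tau>\<delta> :: "'m \<Rightarrow> real^'n \<Rightarrow> ((real^2) \<times> real) L2"
    and \<tau>d\<delta> :: "'m \<Rightarrow> 'n \<Rightarrow> real^'n \<Rightarrow> ((real^2) \<times> real) L2"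
    and B :: "real^'n \<Rightarrow> ((real^2) \<times> real) L2 \<Rightarrow> real^'m"
    and F :: "real^'n \<Rightarrow> (real^2) L2 \<Rightarrow> real^'m"
    and Cpost :: "real^'n \<Rightarrow> (real^2) L2 \<Rightarrow> (real^2) L2"
    and \<xi> :: "real^'n" and j :: 'n
  assumes \<Omega>: "open \<Omega>" "bounded \<Omega>" "convex \<Omega>"
    and T: "is_interval T" "bounded T"
    and Ty: "is_interval Ty" "compact Ty" "Ty \<subseteq> T"
    and tm: "\<And>k. tm k \<in> Ty"
    and r_range: "\<And>t \<eta>. t \<in> Ty \<Longrightarrow> r t \<eta> \<in> \<Omega>"
    and r_measurable: "\<And>\<eta>. (\<lambda>t. r t \<eta>) \<in> borel_measurable (lebesgue_on Ty)"
    and r_pd: "\<And>i t \<eta>. t \<in> Ty \<Longrightarrow> has_pd i (r t) \<eta>"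
    and r_pd_cont: "\<And>i. continuous_on (Ty \<times> UNIV) (\<lambda>(t, \<eta>). pd i (r t) \<eta>)"
    and pos: "\<epsilon>x > 0" "\<epsilon>t > 0" "\<sigma>\<^sup>2 > 0" "a1 > 0" "a2 > 0"
    and \<M>: "\<M> = L2_on \<Omega>"
    and \<U>: "\<U> = L2_on (\<Omega> \<times> T)"
    and S: "bounded_operator \<M> \<U> S"
    and E: "elliptic_operator \<Omega> a1 a2 D E"
    and Cpr: "inverse_square_of \<M> D E Cpr" "covariance_operator \<M> Cpr"
    and \<delta>: "\<And>\<eta>. \<delta> \<eta> = L2_of (\<Omega> \<times> Ty) (\<lambda>(x, t). delta_path \<epsilon>x r x t \<eta>)"
    and d\<delta>: "\<And>i \<eta>. d\<delta> i \<eta> = L2_of (\<Omega> \<times> Ty) (\<lambda>(x, t). pd i (delta_path \<epsilon>x r x t) \<eta>)"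
    and \<tau>\<delta>: "\<And>k \<eta>. \<tau>\<delta> k \<eta> =
           L2_of (\<Omega> \<times> Ty) (\<lambda>(x, t). mollifier \<epsilon>t (tm k) t * delta_path \<epsilon>x r x t \<eta>)"
    and \<tau>d\<delta>: "\<And>k i \<eta>. \<tau>d\<delta> k i \<eta> =
           L2_of (\<Omega> \<times> Ty) (\<lambda>(x, t). mollifier \<epsilon>t (tm k) t * pd i (delta_path \<epsilon>x r x t) \<eta>)"
    and B: "\<And>\<eta> u. B \<eta> u = (\<chi> k. inner (\<tau>\<delta> k \<eta>) u)"
    and F: "\<And>\<eta>. F \<eta> = B \<eta> \<circ> S"
    and Cpost: "\<And>\<eta>. Cpost \<eta> = posterior_covariance \<M> (\<sigma>\<^sup>2) Cpr (F \<eta>)"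
  shows "((\<lambda>h. \<delta> (\<xi> + h *\<^sub>R axis j 1)) has_vector_derivative d\<delta> j \<xi>) (at 0) \<and>
    (\<exists>dH.
       has_operator_pd \<M> j (\<lambda>\<eta>. data_hessian \<M> (\<sigma>\<^sup>2) (F \<eta>)) dH \<xi> \<and>
       has_operator_pd \<M> j Cpost (\<lambda>f. - Cpost \<xi> (dH (Cpost \<xi> f))) \<xi> \<and>
       (\<forall>f\<in>\<M>. dH f = inverse (\<sigma>\<^sup>2) *\<^sub>R adjoint_on \<M> S
          (\<Sum>k\<in>UNIV. tensor (\<tau>\<delta> k \<xi>) (\<tau>d\<delta> k j \<xi>) (S f) + tensor (\<tau>d\<delta> k j \<xi>) (\<tau>\<delta> k \<xi>) (S f))))"
proof -
  have X: "subspace \<M>" "complete \<M>"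
    unfolding \<M> by (rule subspace_L2_on, rule complete_L2_on, rule \<Omega>(2))
  note kernel = weighted_path_kernel_has_vector_derivative[OF \<Omega>(1,2) Ty(2) r_range r_measurable
      r_pd r_pd_cont pos(1)]
  have d\<delta>': "((\<lambda>h. \<delta> (\<xi> + h *\<^sub>R axis j 1)) has_vector_derivative d\<delta> j \<xi>) (at 0)"
    unfolding \<delta> d\<delta> using kernel[of "\<lambda>_. 1" \<xi> j] by simp
  have d\<tau>\<delta>: "((\<lambda>h. \<tau>\<delta> k (\<xi> + h *\<^sub>R axis j 1)) has_vector_derivative \<tau>d\<delta> k j \<xi>) (at 0)" for k
    unfolding \<tau>\<delta> \<tau>d\<delta> mollifier_def using pos(2) by (intro kernel) (auto intro!: continuous_intros)
  define S' where "S' = adjoint_on \<M> S"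
  note S'_mem = adjoint_on(1)[OF X S, folded S'_def]
  note S'_inner = adjoint_on(2)[OF X S, folded S'_def]
  have S'_lin: "bounded_linear S'"
    unfolding S'_def by (rule bounded_linear_adjoint_on[OF X S])
  have "bounded_operator \<M> \<M> Cpr" "self_adjoint_on \<M> Cpr" "strictly_positive_on \<M> Cpr"
    using Cpr(2) by (auto simp: covariance_operator_def)
  moreover have obs: "inner v (S f) = inner (S' v) f" if "f \<in> \<M>" for v f
    using S'_inner[OF that, of v] by (simp add: inner_commute)
  ultimately have bayes: "linear_bayes \<M> Cpr (\<sigma>\<^sup>2) (\<lambda>k. S' (\<tau>\<delta> k \<eta>)) (F \<eta>)" for \<eta>
    using X(1) S'_mem pos(3) by unfold_locales (auto simp: F B)
  define dH where "dH f = inverse (\<sigma>\<^sup>2) *\<^sub>R (\<Sum>k\<in>UNIV.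
    tensor (S' (\<tau>\<delta> k \<xi>)) (S' (\<tau>d\<delta> k j \<xi>)) f + tensor (S' (\<tau>d\<delta> k j \<xi>)) (S' (\<tau>\<delta> k \<xi>)) f)" for f
  have "((\<lambda>h. S' (\<tau>\<delta> k (\<xi> + h *\<^sub>R axis j 1))) has_vector_derivative S' (\<tau>d\<delta> k j \<xi>)) (at 0)" for k
    using bounded_linear.has_vector_derivative[OF S'_lin d\<tau>\<delta>] .
  then have H: "has_operator_pd \<M> j (\<lambda>\<eta>. data_hessian \<M> (\<sigma>\<^sup>2) (F \<eta>)) dH \<xi>"
    unfolding dH_def[abs_def] using S'_mem by (intro data_hessian_has_operator_pd[OF bayes])
  moreover have "has_operator_pd \<M> j Cpost (\<lambda>f. - Cpost \<xi> (dH (Cpost \<xi> f))) \<xi>"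
    unfolding Cpost[abs_def] by (rule posterior_covariance_has_operator_pd[OF bayes H])
  moreover have "dH f = inverse (\<sigma>\<^sup>2) *\<^sub>R adjoint_on \<M> S
      (\<Sum>k\<in>UNIV. tensor (\<tau>\<delta> k \<xi>) (\<tau>d\<delta> k j \<xi>) (S f) + tensor (\<tau>d\<delta> k j \<xi>) (\<tau>\<delta> k \<xi>) (S f))"
    if "f \<in> \<M>" for f
    unfolding S'_def[symmetric]
    by (simp add: dH_def tensor_def obs[OF that] linear_sum linear_add linear_scale
        bounded_linear.linear[OF S'_lin])
  ultimately show ?thesis using d\<delta>' by blast
qed

end
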